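(* Let $p$ be an odd prime and let $G$ be a quasi-powerful $p$-group. If $x,y\in G$ are such that $o(x)\le p^{i+1}$ and $o(y)\le p^{i}$ (for some integer $i\ge 0$), then $o([x^{p^{j}},y^{p^{k}}])\le p^{i-j-k}$ for all integers $j,k\ge 0$.
   Context: For an odd prime $p$, a finite $p$-group $G$ is powerful if $[G,G]\le G^{p}$, and $G$ is quasi-powerful if $G/Z(G)$ is powerful. $o(g)$ denotes the order of $g$. Convention: for an element $g$ of a $p$-group and an integer $m<0$, the inequality $o(g)\le p^{m}$ means $g=1$. *)

theory Defs
  imports "HOL-Algebra.Algebra"
begin

definition commutator :: "('a, 'b) monoid_scheme \<Rightarrow> 'a \<Rightarrow> 'a \<Rightarrow> 'a" where
  "commutator G x y = inv\<^bsub>G\<^esub> x \<otimes>\<^bsub>G\<^esub> inv\<^bsub>G\<^esub> y \<otimes>\<^bsub>G\<^esub> x \<otimes>\<^bsub>G\<^esub> y"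

definition center :: "('a, 'b) monoid_scheme \<Rightarrow> 'a set" where
  "center G = {z \<in> carrier G. \<forall>g \<in> carrier G. z \<otimes>\<^bsub>G\<^esub> g = g \<otimes>\<^bsub>G\<^esub> z}"

definition power_subgroup :: "('a, 'b) monoid_scheme \<Rightarrow> nat \<Rightarrow> 'a set" where
  "power_subgroup G p = generate G {x [^]\<^bsub>G\<^esub> p | x. x \<in> carrier G}"

definition p_group :: "('a, 'b) monoid_scheme \<Rightarrow> nat \<Rightarrow> bool" where
  "p_group G p \<longleftrightarrow> group G \<and> finite (carrier G) \<and> (\<exists>n. order G = p ^ n)"

definition powerful :: "('a, 'b) monoid_scheme \<Rightarrow> nat \<Rightarrow> bool" where
  "powerful G p \<longleftrightarrow> p_group G p \<and> derived G (carrier G) \<subseteq> power_subgroup G p"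

definition quasi_powerful :: "('a, 'b) monoid_scheme \<Rightarrow> nat \<Rightarrow> bool" where
  "quasi_powerful G p \<longleftrightarrow> p_group G p \<and> powerful (G Mod center G) p"

end

theory Submission
  imports Defs
begin

text \<open>Write \<open>Z\<close> for the centre of \<open>G\<close> and measure orders of elements modulo \<open>Z\<close>: since a commutator
  depends only on its arguments modulo \<open>Z\<close>, the hypotheses may be weakened to
  \<open>x ^ (p ^ (i + 1)) \<in> Z\<close> and \<open>y ^ (p ^ i) \<in> Z\<close>, while the conclusion still bounds the true order of
  the commutator. All subgroups \<open>H \<supseteq> Z\<close> with \<open>H / Z\<close> powerful are treated together, by induction on
  their cardinality. The induction carries the statement that \<open>x \<mapsto> x ^ (p ^ i)\<close> is multiplicative on
  the elements that it sends into \<open>Z\<close>. For non-abelian \<open>H\<close> and \<open>u \<in> H\<close>, the subgroup generated by \<open>u\<close>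
  and the \<open>p\<close>-th powers is proper and again powerful modulo \<open>Z\<close>. The inductive hypothesis makes its
  elements of order at most \<open>p ^ m\<close> into a normal subgroup, and modulo that subgroup the relevant
  two-generator subgroups have class at most two, so that the collection formula reduces to
  \<open>(a b) ^ p = a ^ p b ^ p\<close>, as \<open>p\<close> divides \<open>p choose 2\<close>. No longer collection is needed because
  \<open>[H, H]\<close> consists of \<open>p\<close>-th powers (modulo \<open>Z\<close>), and commutators with higher powers are controlled
  by downward induction on \<open>i\<close>.\<close>

section \<open>Commutators and quotients\<close>

context group
begin

abbreviation comm :: "'a \<Rightarrow> 'a \<Rightarrow> 'a" where
  "comm \<equiv> commutator G"

lemma comm_closed [simp, intro]:
  "x \<in> carrier G \<Longrightarrow> y \<in> carrier G \<Longrightarrow> comm x y \<in> carrier G"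
  by (simp add: commutator_def)

lemma inv_cancel [simp]:
  assumes "x \<in> carrier G" "y \<in> carrier G"
  shows "inv x \<otimes> (x \<otimes> y) = y" "x \<otimes> (inv x \<otimes> y) = y"
  using assms by (simp_all flip: m_assoc)

lemma comm_eq_one_iff:
  assumes "x \<in> carrier G" "y \<in> carrier G"
  shows "comm x y = \<one> \<longleftrightarrow> x \<otimes> y = y \<otimes> x"
proof
  assume "comm x y = \<one>"
  then have "y \<otimes> x \<otimes> comm x y = y \<otimes> x" using assms by simp
  then show "x \<otimes> y = y \<otimes> x"
    using assms by (simp add: commutator_def m_assoc)
next
  assume "x \<otimes> y = y \<otimes> x"
  then show "comm x y = \<one>"
    using assms by (simp add: commutator_def m_assoc)
qed

lemma inv_commutes:
  assumes "x \<in> carrier G" "y \<in> carrier G" "x \<otimes> y = y \<otimes> x"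
  shows "inv x \<otimes> y = y \<otimes> inv x"
proof -
  have "inv x \<otimes> y = inv x \<otimes> (y \<otimes> x) \<otimes> inv x"
    using assms(1,2) by (simp add: m_assoc)
  also have "\<dots> = y \<otimes> inv x"
    unfolding assms(3)[symmetric] using assms(1,2) by (simp add: m_assoc)
  finally show ?thesis .
qed

lemma mult_commutes:
  assumes "x \<in> carrier G" "y \<in> carrier G" "g \<in> carrier G"
    and x: "x \<otimes> g = g \<otimes> x" and y: "y \<otimes> g = g \<otimes> y"
  shows "x \<otimes> y \<otimes> g = g \<otimes> (x \<otimes> y)"
proof -
  have "x \<otimes> y \<otimes> g = x \<otimes> g \<otimes> y"
    using assms(1-3) by (simp add: m_assoc y)
  then show ?thesis unfolding x using assms(1-3) by (simp add: m_assoc)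
qed

lemma inv_comm:
  assumes "x \<in> carrier G" "y \<in> carrier G"
  shows "inv (comm x y) = comm y x"
  using assms by (simp add: commutator_def m_assoc inv_mult_group)

lemma conj_eq_mult_comm:
  assumes "x \<in> carrier G" "y \<in> carrier G"
  shows "inv y \<otimes> x \<otimes> y = x \<otimes> comm x y"
  using assms by (simp add: commutator_def m_assoc)

lemma conj_pow:
  fixes n :: nat
  assumes "x \<in> carrier G" "y \<in> carrier G"
  shows "(inv y \<otimes> x \<otimes> y) [^] n = inv y \<otimes> x [^] n \<otimes> y"
  using assms by (induction n) (simp_all add: m_assoc)

lemma comm_pow_left:
  fixes n :: nat
  assumes "x \<in> carrier G" "y \<in> carrier G"
  shows "comm (x [^] n) y = inv (x [^] n) \<otimes> (x \<otimes> comm x y) [^] n"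
proof -
  have "(x \<otimes> comm x y) [^] n = inv y \<otimes> x [^] n \<otimes> y"
    unfolding conj_eq_mult_comm[OF assms, symmetric] by (rule conj_pow[OF assms])
  then show ?thesis using assms by (simp add: commutator_def m_assoc)
qed

text \<open>Collection in class two: moving one \<open>a\<close> past \<open>b [^] n\<close> costs
  \<open>n\<close> copies of the commutator, which commutes with everything involved, and these
  costs add up to \<open>n choose 2\<close>.\<close>

lemma pow_mult_class_two:
  fixes n :: nat
  assumes a: "a \<in> carrier G" and b: "b \<in> carrier G"
    and ca: "comm a b \<otimes> a = a \<otimes> comm a b" and cb: "comm a b \<otimes> b = b \<otimes> comm a b"
  shows "a [^] n \<otimes> b [^] n = (a \<otimes> b) [^] n \<otimes> comm a b [^] (n choose 2)"
proof (induction n)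
  case 0
  then show ?case by (simp add: numeral_2_eq_2)
next
  case (Suc n)
  define e where "e = comm a b"
  have e: "e \<in> carrier G" and ea: "e \<otimes> a = a \<otimes> e" and eb: "e \<otimes> b = b \<otimes> e"
    using a b ca cb by (auto simp: e_def)
  have ab: "a \<otimes> b = b \<otimes> a \<otimes> e"
    using a b by (simp add: e_def commutator_def m_assoc)
  have eab: "e [^] k \<otimes> (a \<otimes> b) = a \<otimes> b \<otimes> e [^] k" for k :: nat
    using group_commutes_pow[of e "a \<otimes> b" k] a b e ea eb by (metis m_assoc m_closed)
  have ebk: "e [^] k \<otimes> b = b \<otimes> e [^] k" for k :: nat
    using group_commutes_pow[of e b k] b e eb by simp
  have swap: "a \<otimes> b [^] k = b [^] k \<otimes> a \<otimes> e [^] k" for k :: nat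
  proof (induction k)
    case (Suc k)
    have "a \<otimes> b [^] Suc k = a \<otimes> b [^] k \<otimes> b"
      using a b by (simp add: m_assoc)
    also have "\<dots> = b [^] k \<otimes> a \<otimes> (e [^] k \<otimes> b)"
      unfolding Suc using a b e by (simp add: m_assoc)
    also have "\<dots> = b [^] k \<otimes> (a \<otimes> b) \<otimes> e [^] k"
      using a b e by (simp add: ebk m_assoc)
    also have "\<dots> = b [^] Suc k \<otimes> a \<otimes> (e \<otimes> e [^] k)"
      using a b e by (simp add: ab m_assoc)
    finally show ?case using a b e nat_pow_Suc2[OF e] by simp
  qed (use a in simp)
  have bn: "b [^] n \<otimes> a \<otimes> e [^] n \<otimes> b = b [^] n \<otimes> (a \<otimes> b) \<otimes> e [^] n"
    using a b e by (simp add: m_assoc ebk)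
  have ch: "Suc n choose 2 = (n choose 2) + n"
    by (simp add: numeral_2_eq_2)
  have "a [^] Suc n \<otimes> b [^] Suc n = a [^] n \<otimes> (a \<otimes> b [^] n) \<otimes> b"
    using a b by (simp add: m_assoc)
  also have "\<dots> = a [^] n \<otimes> (b [^] n \<otimes> a \<otimes> e [^] n \<otimes> b)"
    unfolding swap using a b e by (simp add: m_assoc)
  also have "\<dots> = (a [^] n \<otimes> b [^] n) \<otimes> (a \<otimes> b) \<otimes> e [^] n"
    unfolding bn using a b e by (simp add: m_assoc)
  also have "\<dots> = (a \<otimes> b) [^] n \<otimes> (e [^] (n choose 2) \<otimes> (a \<otimes> b)) \<otimes> e [^] n"
    unfolding Suc e_def[symmetric] using a b e by (simp add: m_assoc)
  also have "\<dots> = (a \<otimes> b) [^] Suc n \<otimes> (e [^] (n choose 2) \<otimes> e [^] n)"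
    unfolding eab using a b e by (simp add: m_assoc)
  also have "e [^] (n choose 2) \<otimes> e [^] n = e [^] (Suc n choose 2)"
    unfolding ch using e by (simp add: nat_pow_mult)
  finally show ?case unfolding e_def .
qed

text \<open>Both subgroups remain sets inside one fixed group, so that the later induction over
  subgroups never changes the ambient structure.\<close>

definition normal_in :: "'a set \<Rightarrow> 'a set \<Rightarrow> bool" where
  "normal_in N H \<longleftrightarrow> subgroup N G \<and> subgroup H G \<and> N \<subseteq> H \<and>
     (\<forall>h\<in>H. \<forall>x\<in>N. inv h \<otimes> x \<otimes> h \<in> N)"

text \<open>An interface to \<open>H / N\<close>: an epimorphism with kernel \<open>N\<close>.
  Compatibility with powers and commutators and the index formula are included so that later
  arguments never return to cosets.\<close>

definition quotient_map :: "'a set \<Rightarrow> 'a set \<Rightarrow> 'c monoid \<Rightarrow> ('a \<Rightarrow> 'c) \<Rightarrow> bool" where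
  "quotient_map N H Q \<pi> \<longleftrightarrow> group Q \<and> \<pi> ` H = carrier Q \<and> card (carrier Q) * card N = card H \<and>
     (\<forall>x\<in>H. \<forall>y\<in>H. \<pi> (x \<otimes> y) = \<pi> x \<otimes>\<^bsub>Q\<^esub> \<pi> y) \<and>
     (\<forall>x\<in>H. \<pi> (inv x) = inv\<^bsub>Q\<^esub> \<pi> x) \<and>
     (\<forall>x\<in>H. \<forall>n. \<pi> (x [^] (n::nat)) = \<pi> x [^]\<^bsub>Q\<^esub> n) \<and>
     (\<forall>x\<in>H. \<forall>y\<in>H. \<pi> (comm x y) = commutator Q (\<pi> x) (\<pi> y)) \<and>
     (\<forall>x\<in>H. \<pi> x = \<one>\<^bsub>Q\<^esub> \<longleftrightarrow> x \<in> N)"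

lemma quotient_mapD:
  assumes "quotient_map N H Q \<pi>"
  shows "group Q" "\<pi> ` H = carrier Q" "card (carrier Q) * card N = card H"
    "\<And>x. x \<in> H \<Longrightarrow> \<pi> x \<in> carrier Q"
    "\<And>x y. x \<in> H \<Longrightarrow> y \<in> H \<Longrightarrow> \<pi> (x \<otimes> y) = \<pi> x \<otimes>\<^bsub>Q\<^esub> \<pi> y"
    "\<And>x. x \<in> H \<Longrightarrow> \<pi> (inv x) = inv\<^bsub>Q\<^esub> \<pi> x"
    "\<And>x n. x \<in> H \<Longrightarrow> \<pi> (x [^] (n::nat)) = \<pi> x [^]\<^bsub>Q\<^esub> n"
    "\<And>x y. x \<in> H \<Longrightarrow> y \<in> H \<Longrightarrow> \<pi> (comm x y) = commutator Q (\<pi> x) (\<pi> y)"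
    "\<And>x. x \<in> H \<Longrightarrow> \<pi> x = \<one>\<^bsub>Q\<^esub> \<longleftrightarrow> x \<in> N"
  using assms unfolding quotient_map_def by blast+

lemma ex_quotient_map:
  assumes "normal_in N H"
  obtains Q :: "'a set monoid" and \<pi> where "quotient_map N H Q \<pi>"
proof -
  have H: "subgroup H G" and N: "subgroup N G" and NH: "N \<subseteq> H"
    using assms by (auto simp: normal_in_def)
  define K where "K = G\<lparr>carrier := H\<rparr>"
  interpret H: group K unfolding K_def by (rule subgroup_imp_group[OF H])
  have Hc: "\<And>x. x \<in> H \<Longrightarrow> x \<in> carrier G" by (rule subgroup.mem_carrier[OF H])
  have invK: "inv\<^bsub>K\<^esub> x = inv x" if "x \<in> H" for x
    unfolding K_def using m_inv_consistent[OF H that] .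
  have "subgroup N K" unfolding K_def using subgroup_incl[OF N H NH] .
  moreover have "x \<otimes>\<^bsub>K\<^esub> h \<otimes>\<^bsub>K\<^esub> inv\<^bsub>K\<^esub> x \<in> N" if "x \<in> carrier K" "h \<in> N" for x h
  proof -
    have xH: "x \<in> H" using that by (simp add: K_def)
    then have ix: "inv x \<in> H" using H by (simp add: subgroup.m_inv_closed)
    have "inv (inv x) \<otimes> h \<otimes> inv x \<in> N"
      using assms ix that unfolding normal_in_def by blast
    then show ?thesis unfolding invK[OF xH] using xH Hc by (simp add: K_def)
  qed
  ultimately have nK: "N \<lhd> K" using H.normal_inv_iff by blast
  interpret nK: normal N K by (rule nK)
  define Q where "Q = K Mod N"
  define \<pi> where "\<pi> = (\<lambda>a. N #>\<^bsub>K\<^esub> a)"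
  have "\<pi> \<in> hom K Q" unfolding \<pi>_def Q_def by (rule nK.r_coset_hom_Mod)
  then have gh: "group_hom K Q \<pi>"
    unfolding group_hom_def group_hom_axioms_def Q_def
    using nK.factorgroup_is_group H.group_axioms by blast
  interpret h: group_hom K Q \<pi> by (rule gh)
  have cK: "carrier K = H" by (simp add: K_def)
  have mu: "\<pi> (x \<otimes> y) = \<pi> x \<otimes>\<^bsub>Q\<^esub> \<pi> y" if "x \<in> H" "y \<in> H" for x y
    using h.hom_mult[of x y] that by (simp add: K_def)
  have iv: "\<pi> (inv x) = inv\<^bsub>Q\<^esub> \<pi> x" if "x \<in> H" for x
    using h.hom_inv[of x] that invK cK by simp
  have pw: "\<pi> (x [^] (n::nat)) = \<pi> x [^]\<^bsub>Q\<^esub> n" if "x \<in> H" for x n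
    using h.hom_nat_pow[of x n] that cK nat_pow_consistent[of x n H] by (simp add: K_def)
  have cl: "\<pi> x \<in> carrier Q" if "x \<in> H" for x using that cK h.hom_closed by blast
  show thesis
  proof (rule that[of Q \<pi>], unfold quotient_map_def, intro conjI ballI allI)
    show "group Q" by (rule h.H.group_axioms)
    show "\<pi> ` H = carrier Q" by (auto simp: Q_def \<pi>_def FactGroup_def RCOSETS_def cK)
    show "\<pi> (comm x y) = commutator Q (\<pi> x) (\<pi> y)" if "x \<in> H" "y \<in> H" for x y
      using that H by (simp add: commutator_def mu iv subgroup.m_closed[OF H] subgroup.m_inv_closed[OF H])
    show "\<pi> x = \<one>\<^bsub>Q\<^esub> \<longleftrightarrow> x \<in> N" if "x \<in> H" for x
    proof
      assume "\<pi> x = \<one>\<^bsub>Q\<^esub>"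
      then have "N #>\<^bsub>K\<^esub> x = N" by (simp add: \<pi>_def Q_def FactGroup_def)
      then show "x \<in> N" using H.coset_join1[of N x] that cK nK.subgroup_axioms
        using nK.subset by blast
    next
      assume "x \<in> N"
      then have "N #>\<^bsub>K\<^esub> x = N"
        using nK.rcos_const H.group_axioms by blast
      then show "\<pi> x = \<one>\<^bsub>Q\<^esub>" by (simp add: \<pi>_def Q_def FactGroup_def)
    qed
    show "card (carrier Q) * card N = card H"
      using H.lagrange[OF nK.subgroup_axioms] by (simp add: Q_def FactGroup_def order_def cK)
  qed (use mu iv pw cl in auto)
qed

text \<open>For \<open>N\<close> normal in \<open>H\<close> this is the preimage in \<open>H\<close>
  of the centre of \<open>H / N\<close>.\<close>

definition central_mod :: "'a set \<Rightarrow> 'a set \<Rightarrow> 'a set" where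
  "central_mod H N = {x \<in> H. \<forall>g\<in>H. comm x g \<in> N}"

lemma normal_in_central_mod:
  assumes "normal_in N H"
  shows "normal_in (central_mod H N) H" "N \<subseteq> central_mod H N"
proof -
  have H: "subgroup H G" and N: "subgroup N G" and NH: "N \<subseteq> H"
    using assms by (auto simp: normal_in_def)
  obtain Q :: "'a set monoid" and \<pi> where "quotient_map N H Q \<pi>"
    using ex_quotient_map[OF assms] .
  note Q = quotient_mapD(1)[OF this] and cl = quotient_mapD(4)[OF this]
    and mu = quotient_mapD(5)[OF this] and iv = quotient_mapD(6)[OF this]
    and co = quotient_mapD(8)[OF this] and ker = quotient_mapD(9)[OF this]
  interpret Q: group Q by (rule Q)
  have cH: "comm x y \<in> H" if "x \<in> H" "y \<in> H" for x y
    using that H by (simp add: commutator_def subgroup.m_closed[OF H] subgroup.m_inv_closed[OF H])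
  \<comment> \<open>Membership is restated as commuting with every image in \<open>Q\<close>; all
    closure properties are then read off in the quotient.\<close>
  have eq: "x \<in> central_mod H N \<longleftrightarrow> x \<in> H \<and> (\<forall>g\<in>H. \<pi> x \<otimes>\<^bsub>Q\<^esub> \<pi> g = \<pi> g \<otimes>\<^bsub>Q\<^esub> \<pi> x)" for x
    unfolding central_mod_def using ker co cH cl Q.comm_eq_one_iff by (smt (verit) mem_Collect_eq)
  show sub: "N \<subseteq> central_mod H N"
  proof
    fix x assume "x \<in> N"
    then have "x \<in> H" "\<pi> x = \<one>\<^bsub>Q\<^esub>" using NH ker by auto
    then show "x \<in> central_mod H N" using cl by (simp add: eq)
  qed
  have HH: "inv h \<otimes> x \<otimes> h \<in> H" if "x \<in> H" "h \<in> H" for x h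
    using that H by (simp add: subgroup.m_closed[OF H] subgroup.m_inv_closed[OF H])
  have "subgroup (central_mod H N) G"
  proof (rule subgroupI)
    show "central_mod H N \<subseteq> carrier G"
      using subgroup.subset[OF H] by (auto simp: central_mod_def)
    show "central_mod H N \<noteq> {}" using sub N subgroup.one_closed by blast
    show "inv a \<in> central_mod H N" if "a \<in> central_mod H N" for a
    proof -
      have aH: "a \<in> H" using that eq by blast
      have "inv\<^bsub>Q\<^esub> \<pi> a \<otimes>\<^bsub>Q\<^esub> \<pi> g = \<pi> g \<otimes>\<^bsub>Q\<^esub> inv\<^bsub>Q\<^esub> \<pi> a" if "g \<in> H" for g
        by (rule Q.inv_commutes) (use that aH cl eq \<open>a \<in> central_mod H N\<close> in blast)+
      then show ?thesis unfolding eq using aH subgroup.m_inv_closed[OF H] by (simp add: iv)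
    qed
    show "a \<otimes> b \<in> central_mod H N" if "a \<in> central_mod H N" "b \<in> central_mod H N" for a b
    proof -
      have ab: "a \<in> H" "b \<in> H" using that eq by blast+
      have "\<pi> a \<otimes>\<^bsub>Q\<^esub> \<pi> b \<otimes>\<^bsub>Q\<^esub> \<pi> g = \<pi> g \<otimes>\<^bsub>Q\<^esub> (\<pi> a \<otimes>\<^bsub>Q\<^esub> \<pi> b)" if "g \<in> H" for g
        by (rule Q.mult_commutes) (use that ab cl eq \<open>a \<in> central_mod H N\<close> \<open>b \<in> central_mod H N\<close> in blast)+
      then show ?thesis unfolding eq using ab subgroup.m_closed[OF H] by (simp add: mu)
    qed
  qed
  moreover have "inv h \<otimes> x \<otimes> h \<in> central_mod H N" if "h \<in> H" "x \<in> central_mod H N" for h x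
  proof -
    have xH: "x \<in> H" using that(2) eq by blast
    have "\<pi> (inv h \<otimes> x \<otimes> h) = inv\<^bsub>Q\<^esub> \<pi> h \<otimes>\<^bsub>Q\<^esub> (\<pi> x \<otimes>\<^bsub>Q\<^esub> \<pi> h)"
      using that xH H
      by (simp add: mu iv subgroup.m_closed[OF H] subgroup.m_inv_closed[OF H] Q.m_assoc cl)
    also have "\<dots> = \<pi> x" using that xH by (simp add: eq cl)
    finally show ?thesis using that HH xH by (simp add: eq)
  qed
  ultimately show "normal_in (central_mod H N) H"
    using H unfolding normal_in_def by (auto simp: eq)
qed

text \<open>Modulo \<open>N\<close> the images of \<open>a\<close> and \<open>b\<close> generate a
  group of class at most two whose commutator has order dividing \<open>p\<close>, so the collection
  formula has no correction term. All approximate additivity of \<open>p\<close>-th powers below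
  comes from here.\<close>

lemma pow_mult_mod:
  fixes p :: nat
  assumes "normal_in N H" "Factorial_Ring.prime p" "odd p" "a \<in> H" "b \<in> H"
    and "comm a b [^] p \<in> N" "comm (comm a b) a \<in> N" "comm (comm a b) b \<in> N"
  obtains m where "m \<in> N" "(a \<otimes> b) [^] p = a [^] p \<otimes> b [^] p \<otimes> m"
proof -
  have H: "subgroup H G" and N: "subgroup N G" and NH: "N \<subseteq> H"
    using assms by (auto simp: normal_in_def)
  have Hc: "\<And>x. x \<in> H \<Longrightarrow> x \<in> carrier G" by (rule subgroup.mem_carrier[OF H])
  obtain Q :: "'a set monoid" and \<pi> where "quotient_map N H Q \<pi>"
    using ex_quotient_map[OF assms(1)] .
  note Q = quotient_mapD(1)[OF this] and cl = quotient_mapD(4)[OF this]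
    and mu = quotient_mapD(5)[OF this] and iv = quotient_mapD(6)[OF this]
    and co = quotient_mapD(8)[OF this] and ker = quotient_mapD(9)[OF this] and po = quotient_mapD(7)[OF this]
  interpret Q: group Q by (rule Q)
  have H_closed: "x \<otimes> y \<in> H" "inv x \<in> H" if "x \<in> H" "y \<in> H" for x y
    using that H by (simp_all add: subgroup.m_closed[OF H] subgroup.m_inv_closed[OF H])
  have powH: "x [^] (n::nat) \<in> H" if "x \<in> H" for x n
    using that H H_closed by (induction n) (simp_all add: subgroup.one_closed)
  have cH: "comm x y \<in> H" if "x \<in> H" "y \<in> H" for x y
    using that H_closed by (simp add: commutator_def)
  define e where "e = commutator Q (\<pi> a) (\<pi> b)"
  have e: "e \<in> carrier Q" using assms cl by (simp add: e_def)
  have "e [^]\<^bsub>Q\<^esub> p = \<one>\<^bsub>Q\<^esub>"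
    using assms(4-6) ker[OF powH[OF cH[OF assms(4,5)]], of p]
    by (simp add: po[OF cH[OF assms(4,5)]] co e_def)
  \<comment> \<open>Oddness enters here: \<open>p\<close> differs from 2, so it divides the binomial
    coefficient.\<close>
  moreover have "p dvd p choose 2"
    using assms(2,3) prime_gt_1_nat[of p]
    by (intro dvd_choose_prime) (auto simp: numeral_2_eq_2 intro!: Suc_lessI)
  ultimately have "e [^]\<^bsub>Q\<^esub> (p choose 2) = \<one>\<^bsub>Q\<^esub>"
    using e by (metis Q.nat_pow_one Q.nat_pow_pow dvdE)
  moreover have "e \<otimes>\<^bsub>Q\<^esub> \<pi> a = \<pi> a \<otimes>\<^bsub>Q\<^esub> e" "e \<otimes>\<^bsub>Q\<^esub> \<pi> b = \<pi> b \<otimes>\<^bsub>Q\<^esub> e"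
    using assms ker[of "comm (comm a b) a"] ker[of "comm (comm a b) b"] cH cl e
    by (simp_all add: co Q.comm_eq_one_iff flip: e_def)
  ultimately have "\<pi> a [^]\<^bsub>Q\<^esub> p \<otimes>\<^bsub>Q\<^esub> \<pi> b [^]\<^bsub>Q\<^esub> p = (\<pi> a \<otimes>\<^bsub>Q\<^esub> \<pi> b) [^]\<^bsub>Q\<^esub> p"
    using Q.pow_mult_class_two[of "\<pi> a" "\<pi> b" p] assms cl by (simp add: e_def)
  then have "\<pi> (inv (a [^] p \<otimes> b [^] p) \<otimes> (a \<otimes> b) [^] p) = \<one>\<^bsub>Q\<^esub>"
    using assms powH H_closed cl by (simp add: mu iv po)
  then have "inv (a [^] p \<otimes> b [^] p) \<otimes> (a \<otimes> b) [^] p \<in> N"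
    using assms powH H_closed ker by simp
  then show thesis
    using that[of "inv (a [^] p \<otimes> b [^] p) \<otimes> (a \<otimes> b) [^] p"] assms Hc by simp
qed

end

section \<open>Nilpotency and the Frattini argument\<close>

context group
begin

lemma comm_mult_central:
  assumes "x \<in> carrier G" "y \<in> carrier G" "s \<in> carrier G"
    and s: "\<And>g. g \<in> carrier G \<Longrightarrow> s \<otimes> g = g \<otimes> s"
  shows "comm (x \<otimes> s) y = comm x y" "comm y (x \<otimes> s) = comm y x"
proof -
  have *: "comm u v = inv (v \<otimes> u) \<otimes> (u \<otimes> v)" if "u \<in> carrier G" "v \<in> carrier G" for u v
    using that by (simp add: commutator_def inv_mult_group m_assoc)
  have 1: "x \<otimes> s \<otimes> y = s \<otimes> (x \<otimes> y)" "y \<otimes> (x \<otimes> s) = s \<otimes> (y \<otimes> x)"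
    using assms(1-3) s[of "y \<otimes> x", symmetric] by (simp_all add: m_assoc flip: s[OF assms(1)])
  show "comm (x \<otimes> s) y = comm x y"
    unfolding *[OF m_closed[OF assms(1,3)] assms(2)] *[OF assms(1,2)] 1
    using assms(1-3) by (simp add: inv_mult_group m_assoc)
  then show "comm y (x \<otimes> s) = comm y x"
    using assms(1-3) inv_comm[of "x \<otimes> s" y] inv_comm[of x y] by simp
qed

lemma subgroup_pow_closed:
  fixes n :: nat
  assumes "subgroup H G" "x \<in> H"
  shows "x [^] n \<in> H"
  using subgroup.m_closed[OF assms(1)] subgroup.one_closed[OF assms(1)] assms(2)
  by (induction n) simp_all

lemma subgroup_comm_closed:
  assumes "subgroup H G" "x \<in> H" "y \<in> H"
  shows "comm x y \<in> H"
  using subgroup.m_closed[OF assms(1)] subgroup.m_inv_closed[OF assms(1)] assms(2,3)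
  by (simp add: commutator_def)

lemma normal_inI:
  assumes "subgroup N G" "subgroup H G" "N \<subseteq> H"
    and "\<And>x h. x \<in> N \<Longrightarrow> h \<in> H \<Longrightarrow> comm x h \<in> N"
  shows "normal_in N H"
  unfolding normal_in_def
proof (intro conjI ballI)
  fix h x assume "h \<in> H" "x \<in> N"
  then have "inv h \<otimes> x \<otimes> h = x \<otimes> comm x h"
    using conj_eq_mult_comm subgroup.mem_carrier[OF assms(1)] subgroup.mem_carrier[OF assms(2)]
    by blast
  then show "inv h \<otimes> x \<otimes> h \<in> N"
    using subgroup.m_closed[OF assms(1)] assms(4) \<open>h \<in> H\<close> \<open>x \<in> N\<close> by simp
qed (use assms in auto)

lemma normal_in_comm:
  assumes "normal_in N H" "x \<in> N" "h \<in> H"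
  shows "comm x h \<in> N" "comm h x \<in> N"
proof -
  have N: "subgroup N G" and H: "subgroup H G" using assms(1) by (auto simp: normal_in_def)
  have c: "x \<in> carrier G" "h \<in> carrier G"
    using assms subgroup.mem_carrier[OF N] subgroup.mem_carrier[OF H] by auto
  have "inv h \<otimes> x \<otimes> h \<in> N" using assms by (auto simp: normal_in_def)
  then have "inv x \<otimes> (inv h \<otimes> x \<otimes> h) \<in> N"
    using subgroup.m_closed[OF N] subgroup.m_inv_closed[OF N] assms(2) by blast
  then show *: "comm x h \<in> N" using c by (simp add: commutator_def m_assoc)
  show "comm h x \<in> N"
    using subgroup.m_inv_closed[OF N *] inv_comm[OF c] by simp
qed

lemma normal_in_carrier_trivial: "normal_in {\<one>} (carrier G)"
  using triv_subgroup subgroup_self by (intro normal_inI) (auto simp: commutator_def)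

text \<open>The class equation: if the centre were trivial, every conjugacy class except that of
  \<open>\<one>\<close> would have size divisible by \<open>p\<close>, and the group order would be
  1 modulo \<open>p\<close>.\<close>

lemma p_group_center_nontrivial:
  assumes "Factorial_Ring.prime p" "order G = p ^ n" "n > 0"
  obtains z where "z \<in> carrier G" "z \<noteq> \<one>" "\<And>g. g \<in> carrier G \<Longrightarrow> z \<otimes> g = g \<otimes> z"
proof (rule ccontr)
  assume "\<not> thesis"
  then have triv: "z = \<one>" if "z \<in> carrier G" "\<And>g. g \<in> carrier G \<Longrightarrow> z \<otimes> g = g \<otimes> z" for z
    using that \<open>(\<And>z. \<lbrakk>z \<in> carrier G; z \<noteq> \<one>; \<And>g. g \<in> carrier G \<Longrightarrow> z \<otimes> g = g \<otimes> z\<rbrakk> \<Longrightarrow> thesis)\<close>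
    by blast
  define \<phi> where "\<phi> = (\<lambda>g. \<lambda>h \<in> carrier G. g \<otimes> h \<otimes> inv g)"
  interpret act: group_action G "carrier G" \<phi>
    unfolding \<phi>_def by (rule action_by_conjugation)
  have fin: "finite (carrier G)"
    using assms prime_gt_0_nat[of p] by (intro card_ge_0_finite) (simp add: order_def)
  define Orb where "Orb = orbits G (carrier G) \<phi>"
  define o1 where "o1 = orbit G \<phi> \<one>"
  have o1: "o1 = {\<one>}" by (auto simp: o1_def orbit_def \<phi>_def intro: exI[of _ \<one>])
  have o1_Orb: "o1 \<in> Orb" by (auto simp: Orb_def orbits_def o1_def)
  have finOrb: "finite Orb" using fin by (auto simp: Orb_def orbits_def)
  have dvd: "p dvd card U" if U: "U \<in> Orb - {o1}" for U
  proof -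
    obtain x where x: "x \<in> carrier G" "U = orbit G \<phi> x" using U by (auto simp: Orb_def orbits_def)
    have "card U dvd p ^ n"
      using act.orbit_stabilizer_theorem[OF x(1)] x(2) assms(2) by (metis dvd_triv_left)
    then obtain k where k: "card U = p ^ k"
      using divides_primepow_nat[OF assms(1)] by blast
    have "k \<noteq> 0"
    proof
      assume "k = 0"
      then have "card U = 1" using k by simp
      moreover have "x \<in> U" using act.orbit_refl x by simp
      ultimately have Ux: "U = {x}" by (metis card_1_singletonE singletonD)
      have "x \<otimes> g = g \<otimes> x" if "g \<in> carrier G" for g
      proof -
        have "g \<otimes> x \<otimes> inv g \<in> orbit G \<phi> x" using that x(1) by (auto simp: orbit_def \<phi>_def)
        then have "g \<otimes> x \<otimes> inv g = x" using Ux x by simp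
        then have "g \<otimes> x \<otimes> inv g \<otimes> g = x \<otimes> g" by simp
        then show ?thesis using that x(1) by (simp add: m_assoc)
      qed
      then have "x = \<one>" using triv x(1) by blast
      then show False using U x(2) by (simp add: o1_def)
    qed
    then show ?thesis using k by simp
  qed
  have "card (carrier G) = (\<Sum>U\<in>Orb. card U)"
  proof -
    have "(\<Sum>U\<in>Orb. card U) = (\<Sum>U\<in>Orb. \<Sum>x\<in>U. 1)"
      by (rule sum.cong) (rule refl, rule card_eq_sum)
    also have "\<dots> = (\<Sum>x\<in>carrier G. 1)"
      unfolding Orb_def by (rule act.disjoint_sum[OF fin])
    also have "\<dots> = card (carrier G)" by (rule card_eq_sum[symmetric])
    finally show ?thesis by (rule sym)
  qed
  also have "\<dots> = card o1 + (\<Sum>U\<in>Orb - {o1}. card U)"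
    using sum.remove[OF finOrb o1_Orb] .
  finally have "card (carrier G) = 1 + (\<Sum>U\<in>Orb - {o1}. card U)" by (simp add: o1)
  moreover have "p dvd (\<Sum>U\<in>Orb - {o1}. card U)" using dvd by (intro dvd_sum) auto
  moreover have "p dvd card (carrier G)" using assms(2,3) by (simp add: order_def)
  ultimately have "p dvd 1" by (metis dvd_add_left_iff)
  then show False using assms(1) by simp
qed

section \<open>The upper central series and nilpotency of finite p-groups\<close>

definition upper_central :: "nat \<Rightarrow> 'a set" where
  "upper_central k = (central_mod (carrier G) ^^ k) {\<one>}"

lemma upper_central_0 [simp]: "upper_central 0 = {\<one>}"
  by (simp add: upper_central_def)

lemma upper_central_Suc: "upper_central (Suc k) = central_mod (carrier G) (upper_central k)"
  by (simp add: upper_central_def)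

lemma normal_in_upper_central: "normal_in (upper_central k) (carrier G)"
proof (induction k)
  case (Suc k)
  then show ?case unfolding upper_central_Suc by (rule normal_in_central_mod)
qed (simp add: normal_in_carrier_trivial)

end

locale finite_p_group = group G for G (structure) +
  fixes p n :: nat
  assumes prime: "Factorial_Ring.prime p" and odd: "odd p" and order: "order G = p ^ n"
begin

lemma finite_carrier: "finite (carrier G)"
  using order prime prime_gt_0_nat[of p] by (intro card_ge_0_finite) (simp add: order_def)

lemma pow_exponent: "x \<in> carrier G \<Longrightarrow> n \<le> m \<Longrightarrow> x [^] (p ^ m) = \<one>"
proof -
  assume "x \<in> carrier G" "n \<le> m"
  then obtain k where "m = n + k" using le_iff_add by blast
  then show ?thesis
    using pow_order_eq_1[OF \<open>x \<in> carrier G\<close>] \<open>x \<in> carrier G\<close>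
    by (simp add: order power_add flip: nat_pow_pow)
qed

text \<open>The quotient by \<open>N\<close> is a nontrivial \<open>p\<close>-group. A preimage of a
  nontrivial central element of it lies in \<open>central_mod\<close> but not in
  \<open>N\<close>.\<close>

lemma central_mod_psubset:
  assumes "normal_in N (carrier G)" "N \<noteq> carrier G"
  shows "N \<subset> central_mod (carrier G) N"
proof -
  obtain Q :: "'a set monoid" and \<pi> where *: "quotient_map N (carrier G) Q \<pi>"
    using ex_quotient_map[OF assms(1)] .
  interpret Q: group Q using quotient_mapD(1)[OF *] .
  have "card (carrier Q) * card N = p ^ n"
    using quotient_mapD(3)[OF *] order by (simp add: order_def)
  then obtain k where k: "card (carrier Q) = p ^ k"
    using divides_primepow_nat[OF prime] by (metis dvd_triv_left)
  have sub: "N \<subseteq> carrier G" using assms by (simp add: normal_in_def)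
  have "k > 0"
  proof (rule ccontr)
    assume "\<not> k > 0"
    then have "card N = card (carrier G)"
      using k quotient_mapD(3)[OF *] by simp
    then show False
      using card_subset_eq[OF finite_carrier sub] assms(2) by simp
  qed
  then obtain z where z: "z \<in> carrier Q" "z \<noteq> \<one>\<^bsub>Q\<^esub>"
    and zc: "\<And>g. g \<in> carrier Q \<Longrightarrow> z \<otimes>\<^bsub>Q\<^esub> g = g \<otimes>\<^bsub>Q\<^esub> z"
    using Q.p_group_center_nontrivial[OF prime, of k] k unfolding order_def by blast
  obtain x where x: "x \<in> carrier G" "z = \<pi> x"
    using z(1) quotient_mapD(2)[OF *] by (metis imageE)
  have "comm x g \<in> N" if "g \<in> carrier G" for g
    using that x z(1) zc quotient_mapD(4,8,9)[OF *] Q.comm_eq_one_iff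
    by (metis comm_closed)
  then have "x \<in> central_mod (carrier G) N" using x by (simp add: central_mod_def)
  moreover have "x \<notin> N" using z(2) x quotient_mapD(9)[OF *] by auto
  ultimately show ?thesis using normal_in_central_mod(2)[OF assms(1)] by blast
qed

text \<open>Below the whole group the upper central series grows strictly, which is impossible
  forever in a finite group.\<close>

lemma nilpotent: obtains c where "upper_central c = carrier G"
proof (rule ccontr)
  assume "\<not> thesis"
  then have ne: "upper_central k \<noteq> carrier G" for k using that by blast
  have "k \<le> card (upper_central k)" for k
  proof (induction k)
    case (Suc k)
    have "upper_central k \<subset> upper_central (Suc k)"
      unfolding upper_central_Suc
      using central_mod_psubset[OF normal_in_upper_central ne] .
    moreover have "finite (upper_central (Suc k))"
      using normal_in_upper_central finite_carrier
      by (meson finite_subset normal_in_def)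
    ultimately have "card (upper_central k) < card (upper_central (Suc k))"
      by (simp add: psubset_card_mono)
    then show ?case using Suc by simp
  qed simp
  moreover have "card (upper_central k) \<le> p ^ n" for k
    using normal_in_upper_central[of k] card_mono[OF finite_carrier] order
    unfolding normal_in_def order_def by metis
  ultimately have "Suc (p ^ n) \<le> p ^ n" by (meson order_trans)
  then show False by simp
qed

end

section \<open>Congruences modulo the upper central series\<close>

context group
begin

lemma quotient_map_eq_iff:
  assumes "quotient_map N H Q \<pi>" "subgroup H G" "a \<in> H" "b \<in> H"
  shows "\<pi> a = \<pi> b \<longleftrightarrow> inv b \<otimes> a \<in> N"
proof -
  note * = assms(1)
  interpret Q: group Q using quotient_mapD(1)[OF *] .
  have "inv b \<in> H" "inv b \<otimes> a \<in> H"
    using assms(3,4) subgroup.m_inv_closed[OF assms(2)] subgroup.m_closed[OF assms(2)] by blast+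
  then have "inv b \<otimes> a \<in> N \<longleftrightarrow> inv\<^bsub>Q\<^esub> \<pi> b \<otimes>\<^bsub>Q\<^esub> \<pi> a = \<one>\<^bsub>Q\<^esub>"
    using assms(3,4) quotient_mapD(5,6)[OF *] quotient_mapD(9)[OF *, of "inv b \<otimes> a"] by simp
  also have "\<dots> \<longleftrightarrow> \<pi> a = \<pi> b"
    using assms(3,4) quotient_mapD(4)[OF *] Q.inv_equality[of "inv\<^bsub>Q\<^esub> \<pi> b" "\<pi> a"] by force
  finally show ?thesis by simp
qed

text \<open>The set is the intersection of \<open>A\<close> with the product of \<open>B\<close> and
  \<open>N\<close>: the elements of \<open>A\<close> whose image in \<open>G / N\<close> is also the
  image of an element of \<open>B\<close>.\<close>

lemma subgroup_near:
  assumes A: "subgroup A G" and B: "subgroup B G" and N: "normal_in N (carrier G)"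
  shows "subgroup {a \<in> A. \<exists>b\<in>B. inv b \<otimes> a \<in> N} G" (is "subgroup ?D G")
proof -
  obtain Q :: "'a set monoid" and \<pi> where *: "quotient_map N (carrier G) Q \<pi>"
    using ex_quotient_map[OF N] .
  note mu = quotient_mapD(5)[OF *] and iv = quotient_mapD(6)[OF *]
  have Ac: "a \<in> carrier G" if "a \<in> A" for a using that subgroup.mem_carrier[OF A] by blast
  have Bc: "b \<in> carrier G" if "b \<in> B" for b using that subgroup.mem_carrier[OF B] by blast
  have D: "a \<in> ?D \<longleftrightarrow> a \<in> A \<and> (\<exists>b\<in>B. \<pi> a = \<pi> b)" for a
    using quotient_map_eq_iff[OF * subgroup_self] Ac Bc by auto
  show ?thesis
  proof (rule subgroupI)
    show "?D \<subseteq> carrier G" using Ac by blast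
    show "?D \<noteq> {}"
      using subgroup.one_closed[OF A] subgroup.one_closed[OF B] D by blast
    show "inv a \<in> ?D" if aD: "a \<in> ?D" for a
    proof -
      obtain b where "a \<in> A" "b \<in> B" "\<pi> a = \<pi> b" using aD unfolding D by blast
      then have "inv a \<in> A" "inv b \<in> B" "\<pi> (inv a) = \<pi> (inv b)"
        using subgroup.m_inv_closed[OF A] subgroup.m_inv_closed[OF B] Ac Bc by (simp_all add: iv)
      then show ?thesis unfolding D by blast
    qed
    show "a \<otimes> a' \<in> ?D" if aD: "a \<in> ?D" "a' \<in> ?D" for a a'
    proof -
      obtain b b' where "a \<in> A" "b \<in> B" "\<pi> a = \<pi> b" "a' \<in> A" "b' \<in> B" "\<pi> a' = \<pi> b'"
        using aD unfolding D by blast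
      then have "a \<otimes> a' \<in> A" "b \<otimes> b' \<in> B" "\<pi> (a \<otimes> a') = \<pi> (b \<otimes> b')"
        using subgroup.m_closed[OF A] subgroup.m_closed[OF B] Ac Bc by (simp_all add: mu)
      then show ?thesis unfolding D by blast
    qed
  qed
qed

text \<open>Each term of the series is central modulo the previous one, and central factors drop out
  of commutators. Taking commutators thus improves a congruence by one step, which drives both
  descents along the series below.\<close>

lemma comm_near:
  assumes "a \<in> carrier G" "b \<in> carrier G" "inv b \<otimes> a \<in> upper_central (Suc k)"
    and "a' \<in> carrier G" "b' \<in> carrier G" "inv b' \<otimes> a' \<in> upper_central (Suc k)"
  shows "inv (comm b b') \<otimes> comm a a' \<in> upper_central k"
proof -
  obtain Q :: "'a set monoid" and \<pi> where *: "quotient_map (upper_central k) (carrier G) Q \<pi>"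
    using ex_quotient_map[OF normal_in_upper_central] .
  note cl = quotient_mapD(4)[OF *] and mu = quotient_mapD(5)[OF *] and co = quotient_mapD(8)[OF *]
  interpret Q: group Q using quotient_mapD(1)[OF *] .
  have central: "\<pi> t \<otimes>\<^bsub>Q\<^esub> g = g \<otimes>\<^bsub>Q\<^esub> \<pi> t"
    if t: "t \<in> upper_central (Suc k)" and g: "g \<in> carrier Q" for t g
  proof -
    have tc: "t \<in> carrier G" using t by (simp add: upper_central_Suc central_mod_def)
    obtain h where h: "h \<in> carrier G" "g = \<pi> h" using g quotient_mapD(2)[OF *] by blast
    have "comm t h \<in> upper_central k"
      using t h by (auto simp: upper_central_Suc central_mod_def)
    then have "Q.comm (\<pi> t) (\<pi> h) = \<one>\<^bsub>Q\<^esub>"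
      using quotient_mapD(9)[OF *, of "comm t h"] co tc h by simp
    then show ?thesis using Q.comm_eq_one_iff cl tc h by blast
  qed
  define s s' where "s = inv b \<otimes> a" and "s' = inv b' \<otimes> a'"
  have eq: "\<pi> a = \<pi> b \<otimes>\<^bsub>Q\<^esub> \<pi> s" "\<pi> a' = \<pi> b' \<otimes>\<^bsub>Q\<^esub> \<pi> s'"
    using assms by (simp_all add: s_def s'_def flip: mu)
  have sc: "s \<in> carrier G" "s' \<in> carrier G" using assms by (simp_all add: s_def s'_def)
  have "Q.comm (\<pi> a) (\<pi> a') = Q.comm (\<pi> b) (\<pi> b' \<otimes>\<^bsub>Q\<^esub> \<pi> s')"
    unfolding eq by (rule Q.comm_mult_central(1)) (use assms sc cl central[of s] in \<open>auto simp: s_def\<close>)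
  also have "\<dots> = Q.comm (\<pi> b) (\<pi> b')"
    by (rule Q.comm_mult_central(2)) (use assms sc cl central[of s'] in \<open>auto simp: s'_def\<close>)
  finally have "\<pi> (comm a a') = \<pi> (comm b b')" using assms by (simp add: co)
  then show ?thesis using quotient_map_eq_iff[OF * subgroup_self] assms by blast
qed

end

context finite_p_group
begin

text \<open>Descent along the upper central series takes the place of maximal subgroups:
  \<open>A\<close> is shown to agree with \<open>B\<close> modulo ever smaller terms, until the
  modulus is trivial.\<close>

lemma frattini:
  assumes A: "subgroup A G" and B: "subgroup B G" and BA: "B \<subseteq> A"
    and gen: "A \<subseteq> generate G (B \<union> {a [^] p | a. a \<in> A})"
  shows "A = B"
proof -
  define D where "D k = {a \<in> A. \<exists>b\<in>B. inv b \<otimes> a \<in> upper_central k}" for k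
  have Ac: "a \<in> carrier G" if "a \<in> A" for a using that subgroup.mem_carrier[OF A] by blast
  have Bc: "b \<in> carrier G" if "b \<in> B" for b using that subgroup.mem_carrier[OF B] by blast
  have step: "A \<subseteq> D k" if hyp: "A \<subseteq> D (Suc k)" for k
  proof -
    have sub: "subgroup (D k) G"
      unfolding D_def by (rule subgroup_near[OF A B normal_in_upper_central])
    have DA: "D k \<subseteq> A" by (auto simp: D_def)
    have comm_D: "comm a a' \<in> D k" if a: "a \<in> A" and a': "a' \<in> A" for a a'
    proof -
      obtain b where b: "b \<in> B" "inv b \<otimes> a \<in> upper_central (Suc k)"
        using hyp a unfolding D_def by blast
      obtain b' where b': "b' \<in> B" "inv b' \<otimes> a' \<in> upper_central (Suc k)"
        using hyp a' unfolding D_def by blast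
      show ?thesis
        unfolding D_def
        using comm_near[OF Ac[OF a] Bc[OF b(1)] b(2) Ac[OF a'] Bc[OF b'(1)] b'(2)]
          subgroup_comm_closed[OF A a a'] subgroup_comm_closed[OF B b(1) b'(1)] by blast
    qed
    \<comment> \<open>\<open>D k\<close> contains all commutators of \<open>A\<close>, so it is
      normal and the quotient \<open>R\<close> is abelian; \<open>B\<close> becomes trivial in
      \<open>R\<close>.\<close>
    have nor: "normal_in (D k) A"
      using sub A DA comm_D by (intro normal_inI) auto
    obtain R :: "'a set monoid" and \<rho> where **: "quotient_map (D k) A R \<rho>"
      using ex_quotient_map[OF nor] .
    note Rg = quotient_mapD(1)[OF **] and Rcl = quotient_mapD(4)[OF **]
      and Rmu = quotient_mapD(5)[OF **] and Riv = quotient_mapD(6)[OF **]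
      and Rpo = quotient_mapD(7)[OF **]
      and Rco = quotient_mapD(8)[OF **] and Rker = quotient_mapD(9)[OF **]
    interpret R: group R using Rg .
    have Rcomm: "\<rho> a \<otimes>\<^bsub>R\<^esub> \<rho> a' = \<rho> a' \<otimes>\<^bsub>R\<^esub> \<rho> a" if "a \<in> A" "a' \<in> A" for a a'
      using Rker[of "comm a a'"] comm_D[OF that] subgroup_comm_closed[OF A that]
      by (simp add: Rco that Rcl R.comm_eq_one_iff)
    have BD: "\<rho> b = \<one>\<^bsub>R\<^esub>" if b: "b \<in> B" for b
    proof -
      have "inv b \<otimes> b \<in> upper_central k"
        using Bc[OF b] normal_in_upper_central[of k] subgroup.one_closed
        by (auto simp: normal_in_def)
      then have "b \<in> D k" using b BA unfolding D_def by blast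
      then show ?thesis using b BA Rker[of b] by blast
    qed
    have gA: "B \<union> {a [^] p | a. a \<in> A} \<subseteq> A"
      using BA subgroup_pow_closed[OF A] by blast
    have gen_A: "x \<in> A" if "x \<in> generate G (B \<union> {a [^] p | a. a \<in> A})" for x
      using that generate_subgroup_incl[OF gA A] by blast
    \<comment> \<open>The \<open>p\<close>-th powers of the abelian group \<open>R\<close> form a
      subgroup, which contains the images of all generators.\<close>
    have pth: "\<exists>a\<in>A. \<rho> x = \<rho> a [^]\<^bsub>R\<^esub> p" if "x \<in> generate G (B \<union> {a [^] p | a. a \<in> A})" for x
      using that
    proof (induction rule: generate.induct)
      case one
      show ?case using subgroup.one_closed[OF A] BD[OF subgroup.one_closed[OF B]]
        by (intro bexI[of _ \<one>]) simp_all
    next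
      case (incl h)
      then show ?case
      proof
        assume "h \<in> B"
        then show ?thesis using subgroup.one_closed[OF A] BD[OF subgroup.one_closed[OF B]] BD
          by (intro bexI[of _ \<one>]) simp_all
      qed (use Rpo in blast)
    next
      case (inv h)
      then show ?case
      proof
        assume "h \<in> B"
        then have "inv h \<in> B" using subgroup.m_inv_closed[OF B] by blast
        then show ?thesis using subgroup.one_closed[OF A] BD[OF subgroup.one_closed[OF B]] BD
          by (intro bexI[of _ \<one>]) simp_all
      next
        assume "h \<in> {a [^] p | a. a \<in> A}"
        then obtain a where "a \<in> A" "h = a [^] p" by blast
        then show ?thesis
          using subgroup.m_inv_closed[OF A] Ac Rpo[of "inv a" p]
          by (intro bexI[of _ "inv a"]) (simp_all add: nat_pow_inv)
      qed
    next
      case (eng x y)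
      then obtain a b where ab: "a \<in> A" "b \<in> A" "\<rho> x = \<rho> a [^]\<^bsub>R\<^esub> p" "\<rho> y = \<rho> b [^]\<^bsub>R\<^esub> p"
        by blast
      then have "\<rho> (x \<otimes> y) = \<rho> (a \<otimes> b) [^]\<^bsub>R\<^esub> p"
        using Rmu gen_A[OF eng(1)] gen_A[OF eng(2)] R.pow_mult_distrib[OF Rcomm] Rcl by simp
      then show ?case using ab subgroup.m_closed[OF A] by blast
    qed
    \<comment> \<open>Every element of \<open>R\<close> being a \<open>p\<close>-th power, roots can
      be extracted repeatedly. At \<open>m = n\<close> the exponent of \<open>G\<close> forces
      \<open>R\<close> to be trivial.\<close>
    have pth_iter: "\<exists>a\<in>A. \<rho> x = \<rho> a [^]\<^bsub>R\<^esub> (p ^ m)" if "x \<in> A" for x m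
    proof (induction m)
      case 0
      then show ?case using that Rcl by (intro bexI[of _ x]) auto
    next
      case (Suc m)
      then obtain a where a: "a \<in> A" "\<rho> x = \<rho> a [^]\<^bsub>R\<^esub> (p ^ m)" by blast
      then obtain b where b: "b \<in> A" "\<rho> a = \<rho> b [^]\<^bsub>R\<^esub> p" using pth gen by blast
      then have "\<rho> x = \<rho> b [^]\<^bsub>R\<^esub> (p ^ Suc m)"
        using a Rcl[OF b(1)] by (simp add: R.nat_pow_pow)
      then show ?case using b by blast
    qed
    show "A \<subseteq> D k"
    proof
      fix x assume x: "x \<in> A"
      then obtain a where a: "a \<in> A" "\<rho> x = \<rho> a [^]\<^bsub>R\<^esub> (p ^ n)" using pth_iter by blast
      then have "\<rho> x = \<rho> \<one>" using pow_exponent[OF Ac[OF a(1)], of n] Rpo[OF a(1), of "p ^ n"] by simp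
      then have "\<rho> x = \<one>\<^bsub>R\<^esub>" using BD[OF subgroup.one_closed[OF B]] by simp
      then show "x \<in> D k" using Rker[OF x] by simp
    qed
  qed
  \<comment> \<open>At the top of the series every element is congruent to \<open>\<one>\<close>.
    The descent ends at \<open>upper_central 0\<close>, where congruence is equality.\<close>
  obtain c where c: "upper_central c = carrier G" using nilpotent .
  have "A \<subseteq> D c"
    using subgroup.one_closed[OF B] Ac by (auto simp: D_def c)
  then have "A \<subseteq> D 0"
    by (induction c) (use step in auto)
  moreover have "D 0 \<subseteq> B"
  proof
    fix a assume "a \<in> D 0"
    then obtain b where "a \<in> A" "b \<in> B" "inv b \<otimes> a = \<one>" by (auto simp: D_def)
    then have "a = b" using Ac Bc inv_equality[of "inv b" a] by force
    then show "a \<in> B" using \<open>b \<in> B\<close> by simp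
  qed
  ultimately show ?thesis using BA by blast
qed

end

section \<open>Powerfully embedded subgroups\<close>

context group
begin

text \<open>This is the preimage of the centralizer of the image of \<open>g\<close> in
  \<open>H / N\<close>.\<close>

lemma subgroup_comm_mod:
  assumes "normal_in N H" "g \<in> H"
  shows "subgroup {x \<in> H. comm x g \<in> N} G"
proof -
  have H: "subgroup H G" using assms(1) by (simp add: normal_in_def)
  obtain Q :: "'a set monoid" and \<pi> where *: "quotient_map N H Q \<pi>"
    using ex_quotient_map[OF assms(1)] .
  note cl = quotient_mapD(4)[OF *] and mu = quotient_mapD(5)[OF *] and iv = quotient_mapD(6)[OF *]
  interpret Q: group Q using quotient_mapD(1)[OF *] .
  have eq: "comm x g \<in> N \<longleftrightarrow> \<pi> x \<otimes>\<^bsub>Q\<^esub> \<pi> g = \<pi> g \<otimes>\<^bsub>Q\<^esub> \<pi> x" if "x \<in> H" for x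
    using quotient_mapD(9)[OF *, of "comm x g"] quotient_mapD(8)[OF *]
      subgroup_comm_closed[OF H that assms(2)] that assms(2) cl by (simp add: Q.comm_eq_one_iff)
  show ?thesis
  proof (rule subgroupI)
    show "{x \<in> H. comm x g \<in> N} \<subseteq> carrier G" using subgroup.mem_carrier[OF H] by blast
    have "\<one> \<in> {x \<in> H. comm x g \<in> N}"
      using assms subgroup.one_closed[of _ G] subgroup.mem_carrier[OF H, of g]
      by (auto simp: normal_in_def commutator_def)
    then show "{x \<in> H. comm x g \<in> N} \<noteq> {}" by blast
    show "inv a \<in> {x \<in> H. comm x g \<in> N}" if "a \<in> {x \<in> H. comm x g \<in> N}" for a
    proof -
      have a: "a \<in> H" "inv a \<in> H" using that subgroup.m_inv_closed[OF H] by auto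
      have "\<pi> a \<otimes>\<^bsub>Q\<^esub> \<pi> g = \<pi> g \<otimes>\<^bsub>Q\<^esub> \<pi> a" using that eq by auto
      from Q.inv_commutes[OF cl[OF a(1)] cl[OF assms(2)] this]
      have "comm (inv a) g \<in> N" unfolding eq[OF a(2)] iv[OF a(1)] .
      then show ?thesis using a by simp
    qed
    show "a \<otimes> b \<in> {x \<in> H. comm x g \<in> N}"
      if "a \<in> {x \<in> H. comm x g \<in> N}" "b \<in> {x \<in> H. comm x g \<in> N}" for a b
    proof -
      have ab: "a \<in> H" "b \<in> H" "a \<otimes> b \<in> H" using that subgroup.m_closed[OF H] by auto
      have "\<pi> a \<otimes>\<^bsub>Q\<^esub> \<pi> g = \<pi> g \<otimes>\<^bsub>Q\<^esub> \<pi> a" "\<pi> b \<otimes>\<^bsub>Q\<^esub> \<pi> g = \<pi> g \<otimes>\<^bsub>Q\<^esub> \<pi> b"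
        using that eq by auto
      from Q.mult_commutes[OF cl[OF ab(1)] cl[OF ab(2)] cl[OF assms(2)] this]
      have "comm (a \<otimes> b) g \<in> N" unfolding eq[OF ab(3)] mu[OF ab(1,2)] .
      then show ?thesis using ab by simp
    qed
  qed
qed

lemma comm_swap:
  assumes "subgroup N G" "x \<in> carrier G" "y \<in> carrier G" "comm x y \<in> N"
  shows "comm y x \<in> N"
  using subgroup.m_inv_closed[OF assms(1,4)] inv_comm[OF assms(2,3)] by simp

text \<open>Centralizers modulo \<open>N\<close> are subgroups, so the condition passes from
  generators to the generated subgroup in one argument, then in the other.\<close>

lemma generate_comm_mod:
  assumes "normal_in N H" "S \<subseteq> H" and S: "\<And>s t. s \<in> S \<Longrightarrow> t \<in> S \<Longrightarrow> comm s t \<in> N"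
    and x: "x \<in> generate G S" and y: "y \<in> generate G S"
  shows "comm x y \<in> N"
proof -
  have H: "subgroup H G" and N: "subgroup N G" using assms(1) by (auto simp: normal_in_def)
  have gen: "generate G S \<subseteq> H" using generate_subgroup_incl[OF assms(2) H] .
  have Hc: "a \<in> carrier G" if "a \<in> H" for a using that subgroup.mem_carrier[OF H] by blast
  have 1: "comm a g \<in> N" if "a \<in> generate G S" "g \<in> H" "\<And>s. s \<in> S \<Longrightarrow> comm s g \<in> N" for a g
  proof -
    have "S \<subseteq> {x \<in> H. comm x g \<in> N}" using that(3) assms(2) by blast
    then show ?thesis
      using generate_subgroup_incl[OF _ subgroup_comm_mod[OF assms(1) that(2)]] that(1) by blast
  qed
  have "comm s x \<in> N" if "s \<in> S" for s
  proof -
    have "comm x s \<in> N" using 1[OF x, of s] that assms(2) S by blast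
    then show ?thesis using comm_swap[OF N] Hc gen x that assms(2) by blast
  qed
  then have "comm y x \<in> N" using 1[OF y, of x] gen x by blast
  then show ?thesis using comm_swap[OF N] Hc gen x y by blast
qed

text \<open>Modulo \<open>N\<close> the element \<open>c\<close> commutes with
  \<open>comm c x\<close>, so that the \<open>k\<close>-th power of the conjugate
  \<open>c \<otimes> comm c x\<close> splits and both sides have the same image.\<close>

lemma comm_pow_mod:
  fixes k :: nat
  assumes "normal_in N H" "c \<in> H" "x \<in> H" "comm (comm c x) c \<in> N"
  shows "comm c x [^] k \<in> N \<longleftrightarrow> comm (c [^] k) x \<in> N"
proof -
  have H: "subgroup H G" using assms(1) by (simp add: normal_in_def)
  have Hc: "a \<in> carrier G" if "a \<in> H" for a using that subgroup.mem_carrier[OF H] by blast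
  obtain Q :: "'a set monoid" and \<pi> where *: "quotient_map N H Q \<pi>"
    using ex_quotient_map[OF assms(1)] .
  note cl = quotient_mapD(4)[OF *] and po = quotient_mapD(7)[OF *] and co = quotient_mapD(8)[OF *]
    and ker = quotient_mapD(9)[OF *]
  interpret Q: group Q using quotient_mapD(1)[OF *] .
  define e where "e = Q.comm (\<pi> c) (\<pi> x)"
  have cx: "comm c x \<in> H" using subgroup_comm_closed[OF H assms(2,3)] .
  have e: "e \<in> carrier Q" using cl assms by (simp add: e_def)
  have "Q.comm e (\<pi> c) = \<one>\<^bsub>Q\<^esub>"
    using assms ker[OF subgroup_comm_closed[OF H cx assms(2)]] cx by (simp add: co e_def)
  then have ec: "\<pi> c \<otimes>\<^bsub>Q\<^esub> e = e \<otimes>\<^bsub>Q\<^esub> \<pi> c" using Q.comm_eq_one_iff e cl assms(2) by simp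
  have "Q.comm (\<pi> c [^]\<^bsub>Q\<^esub> k) (\<pi> x) = e [^]\<^bsub>Q\<^esub> k"
    using Q.comm_pow_left[of "\<pi> c" "\<pi> x" k] Q.pow_mult_distrib[OF ec] cl assms(2,3) e
    by (simp flip: e_def)
  then have "\<pi> (comm c x [^] k) = \<pi> (comm (c [^] k) x)"
    using assms(2,3) cx subgroup_pow_closed[OF H assms(2)] by (simp add: co po e_def)
  then show ?thesis
    using ker[OF subgroup_pow_closed[OF H cx]]
      ker[OF subgroup_comm_closed[OF H subgroup_pow_closed[OF H assms(2)] assms(3)]] by metis
qed

lemma normal_in_subset:
  assumes "normal_in N H" "subgroup K G" "N \<subseteq> K" "K \<subseteq> H"
  shows "normal_in N K"
  using assms unfolding normal_in_def by blast

lemma normal_in_generate: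
  assumes H: "subgroup H G" and S: "S \<subseteq> H"
    and conj: "\<And>s h. s \<in> S \<Longrightarrow> h \<in> H \<Longrightarrow> inv h \<otimes> s \<otimes> h \<in> generate G S"
  shows "normal_in (generate G S) H"
proof -
  have Hc: "a \<in> carrier G" if "a \<in> H" for a using that subgroup.mem_carrier[OF H] by blast
  have Sc: "S \<subseteq> carrier G" using S Hc by blast
  have sub: "subgroup (generate G S) G" using generate_is_subgroup[OF Sc] .
  have "inv h \<otimes> x \<otimes> h \<in> generate G S" if "h \<in> H" "x \<in> generate G S" for h x
    using that(2)
  proof (induction rule: generate.induct)
    case one
    then show ?case using Hc[OF that(1)] subgroup.one_closed[OF sub] by simp
  next
    case (incl s)
    then show ?case using conj that(1) by simp
  next
    case (inv s)
    have "inv (inv h \<otimes> s \<otimes> h) \<in> generate G S"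
      using subgroup.m_inv_closed[OF sub] conj[OF inv that(1)] by blast
    then show ?case using inv S Hc that(1) by (simp add: subset_iff inv_mult_group m_assoc)
  next
    case (eng x y)
    have c: "x \<in> carrier G" "y \<in> carrier G"
      using eng generate_in_carrier[OF Sc] by auto
    have "inv h \<otimes> (x \<otimes> y) \<otimes> h = (inv h \<otimes> x \<otimes> h) \<otimes> (inv h \<otimes> y \<otimes> h)"
      using c Hc[OF that(1)] by (simp add: m_assoc)
    then show ?case using subgroup.m_closed[OF sub] eng by simp
  qed
  then show ?thesis
    unfolding normal_in_def using sub H generate_subgroup_incl[OF S H] by blast
qed

end

locale central_p_group = finite_p_group +
  fixes Z assumes subgroup_Z: "subgroup Z G"
    and Z_central: "\<And>z g. z \<in> Z \<Longrightarrow> g \<in> carrier G \<Longrightarrow> z \<otimes> g = g \<otimes> z"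
begin

text \<open>When \<open>Z\<close> lies in \<open>N\<close>, this is the preimage of the subgroup
  generated by the \<open>p\<close>-th powers of \<open>N / Z\<close>. Adjoining \<open>Z\<close> to
  the generators avoids passing to the quotient.\<close>

definition agemo :: "'a set \<Rightarrow> 'a set" where
  "agemo N = generate G ({x [^] p | x. x \<in> N} \<union> Z)"

lemma Z_carrier: "z \<in> Z \<Longrightarrow> z \<in> carrier G"
  using subgroup.mem_carrier[OF subgroup_Z] .

lemma comm_Z:
  assumes "z \<in> Z" "g \<in> carrier G"
  shows "comm z g = \<one>" "comm g z = \<one>"
  using assms Z_central Z_carrier comm_eq_one_iff by metis+

lemma pow_in_agemo: "x \<in> N \<Longrightarrow> x [^] p \<in> agemo N"
  unfolding agemo_def by (rule generate.incl) blast

lemma Z_subset_agemo: "Z \<subseteq> agemo N"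
  unfolding agemo_def by (auto intro: generate.incl)

lemma agemo_mono: "M \<subseteq> N \<Longrightarrow> agemo M \<subseteq> agemo N"
  unfolding agemo_def by (rule mono_generate) blast

lemma agemo_gens: "subgroup N G \<Longrightarrow> Z \<subseteq> N \<Longrightarrow> {x [^] p | x. x \<in> N} \<union> Z \<subseteq> N"
  using subgroup_pow_closed by blast

lemma agemo_subset: "subgroup N G \<Longrightarrow> Z \<subseteq> N \<Longrightarrow> agemo N \<subseteq> N"
  unfolding agemo_def by (intro generate_subgroup_incl agemo_gens)

lemma normal_in_agemo:
  assumes "normal_in N H" "Z \<subseteq> N"
  shows "normal_in (agemo N) H"
proof -
  have N: "subgroup N G" and H: "subgroup H G" and NH: "N \<subseteq> H"
    using assms(1) by (auto simp: normal_in_def)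
  have Hc: "a \<in> carrier G" if "a \<in> H" for a using that subgroup.mem_carrier[OF H] by blast
  show ?thesis
    unfolding agemo_def
  proof (rule normal_in_generate[OF H])
    show "{x [^] p |x. x \<in> N} \<union> Z \<subseteq> H" using agemo_gens[OF N assms(2)] NH by blast
    fix s h assume s: "s \<in> {x [^] p |x. x \<in> N} \<union> Z" and h: "h \<in> H"
    show "inv h \<otimes> s \<otimes> h \<in> generate G ({x [^] p |x. x \<in> N} \<union> Z)"
    proof (cases "s \<in> Z")
      case True
      then have "inv h \<otimes> s \<otimes> h = s"
        using Hc[OF h] Z_carrier Z_central by (simp add: m_assoc)
      then show ?thesis using s by (auto intro: generate.incl)
    next
      case False
      then obtain x where x: "x \<in> N" "s = x [^] p" using s by blast
      have "inv h \<otimes> x \<otimes> h \<in> N" using assms(1) x h by (auto simp: normal_in_def)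
      then have "(inv h \<otimes> x \<otimes> h) [^] p \<in> {x [^] p |x. x \<in> N} \<union> Z" by blast
      from generate.incl[OF this, of G] show ?thesis
        using conj_pow[of x h p] x(2) Hc[OF h] Hc[of x] NH x(1) by (simp add: subset_iff)
    qed
  qed
qed

text \<open>Relative to the central subgroup \<open>Z\<close> that is factored out, \<open>powerfully_embedded H H\<close> says
  that \<open>H / Z\<close> is powerful.\<close>

definition powerfully_embedded :: "'a set \<Rightarrow> 'a set \<Rightarrow> bool" where
  "powerfully_embedded N H \<longleftrightarrow>
     normal_in N H \<and> Z \<subseteq> N \<and> (\<forall>x\<in>N. \<forall>h\<in>H. comm x h \<in> agemo N)"

text \<open>With \<open>P = agemo N\<close> and \<open>M = agemo P\<close>, collection shows that
  \<open>[P, H]\<close> lies in \<open>M [P, H, H]\<close>. Nilpotency then leaves only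
  \<open>[P, H] \<subseteq> M\<close>.\<close>

lemma powerfully_embedded_agemo:
  assumes "powerfully_embedded N H"
  shows "powerfully_embedded (agemo N) H"
proof -
  define P M where "P = agemo N" and "M = agemo P"
  have norN: "normal_in N H" and ZN: "Z \<subseteq> N"
    and comm_N: "\<And>x h. x \<in> N \<Longrightarrow> h \<in> H \<Longrightarrow> comm x h \<in> P"
    using assms by (auto simp: powerfully_embedded_def P_def)
  have N: "subgroup N G" and H: "subgroup H G" and NH: "N \<subseteq> H"
    using norN by (auto simp: normal_in_def)
  have Hc: "a \<in> carrier G" if "a \<in> H" for a using that subgroup.mem_carrier[OF H] by blast
  have ZP: "Z \<subseteq> P" and ZM: "Z \<subseteq> M" by (auto simp: P_def M_def Z_subset_agemo[THEN subsetD])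
  have norP: "normal_in P H" unfolding P_def by (rule normal_in_agemo[OF norN ZN])
  then have norM: "normal_in M H" unfolding M_def by (rule normal_in_agemo[OF _ ZP])
  have P: "subgroup P G" and PN: "P \<subseteq> N"
    using norP agemo_subset[OF N ZN] by (auto simp: normal_in_def P_def)
  have M: "subgroup M G" and MP: "M \<subseteq> P"
    using norM agemo_subset[OF P ZP] by (auto simp: normal_in_def M_def)
  \<comment> \<open>\<open>step L\<close> is the subgroup \<open>M [L, H]\<close>; hence
    \<open>L1\<close> below is \<open>M [P, H]\<close> and \<open>L2\<close> is
    \<open>M [L1, H]\<close>.\<close>
  define gens where "gens L = M \<union> {comm l h | l h. l \<in> L \<and> h \<in> H}" for L
  define step where "step L = generate G (gens L)" for L
  have step: "normal_in (step L) H" "step L \<subseteq> L" "M \<subseteq> step L"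
    and comm_step: "\<And>l h. l \<in> L \<Longrightarrow> h \<in> H \<Longrightarrow> comm l h \<in> step L"
    if L: "normal_in L H" "M \<subseteq> L" for L
  proof -
    have L': "subgroup L G" "L \<subseteq> H" using L(1) by (auto simp: normal_in_def)
    have "gens L \<subseteq> L" using L(2) normal_in_comm[OF L(1)] by (auto simp: gens_def)
    then show sub: "step L \<subseteq> L" unfolding step_def by (rule generate_subgroup_incl[OF _ L'(1)])
    show "M \<subseteq> step L" unfolding step_def gens_def by (auto intro: generate.incl)
    show *: "comm l h \<in> step L" if "l \<in> L" "h \<in> H" for l h
      unfolding step_def gens_def using that by (intro generate.incl) blast
    have "gens L \<subseteq> carrier G" using \<open>gens L \<subseteq> L\<close> L' Hc by blast
    then have "subgroup (step L) G" unfolding step_def by (rule generate_is_subgroup)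
    then show "normal_in (step L) H" using H sub L'(2) * by (intro normal_inI) auto
  qed
  define L1 L2 where "L1 = step P" and "L2 = step L1"
  note L1 = step[OF norP MP, folded L1_def] and comm_P = comm_step[OF norP MP, folded L1_def]
  note L2 = step[OF L1(1,3), folded L2_def] and comm_L1 = comm_step[OF L1(1,3), folded L2_def]
  have L2': "subgroup L2 G" using L2(1) by (simp add: normal_in_def)
  have L1': "subgroup L1 G" using L1(1) by (simp add: normal_in_def)
  have L1H: "L1 \<subseteq> H" using L1(1) by (simp add: normal_in_def)
  \<comment> \<open>Since \<open>comm (x [^] p) g\<close> is
    \<open>inv (x [^] p) \<otimes> (x \<otimes> c) [^] p\<close>, it suffices to collect the power
    of \<open>x \<otimes> c\<close> modulo \<open>L2\<close>.\<close>
  have comm_pow_L2: "comm (x [^] p) g \<in> L2" if x: "x \<in> N" and g: "g \<in> H" for x g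
  proof -
    define c where "c = comm x g"
    have xH: "x \<in> H" using x NH by blast
    have c: "c \<in> P" "c \<in> H" using comm_N[OF x g] PN NH by (auto simp: c_def)
    have "comm c x \<in> L1" using comm_P[OF c(1) xH] .
    then have e: "comm x c \<in> L1" "comm x c \<in> H"
      using comm_swap[OF L1' Hc[OF c(2)] Hc[OF xH]] L1H by auto
    have ec: "comm (comm x c) c \<in> L2" "comm (comm x c) x \<in> L2"
      using comm_L1[OF e(1)] c xH by auto
    have cp: "c [^] p \<in> M" unfolding M_def using pow_in_agemo[OF c(1)] .
    \<comment> \<open>As \<open>c [^] p\<close> lies in the normal subgroup \<open>M\<close>, so
      does this commutator; \<open>comm_pow_mod\<close> converts it into a bound on the
      \<open>p\<close>-th power of \<open>comm c x\<close>, and inversion then gives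
      \<open>comm x c\<close>.\<close>
    have "comm (c [^] p) x \<in> M" using normal_in_comm[OF norM cp xH] by simp
    then have "comm c x [^] p \<in> L2"
      using comm_pow_mod[OF L2(1) c(2) xH, of p] L2(3) comm_L1[OF \<open>comm c x \<in> L1\<close> c(2)] by blast
    then have "inv (comm c x) [^] p \<in> L2"
      using subgroup.m_inv_closed[OF L2'] nat_pow_inv Hc[OF c(2)] Hc[OF xH] by simp
    then have "comm x c [^] p \<in> L2" using inv_comm Hc[OF c(2)] Hc[OF xH] by simp
    then obtain m where m: "m \<in> L2" "(x \<otimes> c) [^] p = x [^] p \<otimes> c [^] p \<otimes> m"
      using pow_mult_mod[OF L2(1) prime odd xH c(2)] ec by blast
    have mc: "m \<in> carrier G" using subgroup.mem_carrier[OF L2' m(1)] .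
    have "comm (x [^] p) g = c [^] p \<otimes> m"
      using comm_pow_left[OF Hc[OF xH] Hc[OF g], of p] m(2) Hc[OF xH] Hc[OF c(2)] mc
      by (simp add: m_assoc flip: c_def)
    then show ?thesis using subgroup.m_closed[OF L2' _ m(1)] cp L2(3) by auto
  qed
  have "{x [^] p | x. x \<in> N} \<union> Z \<subseteq> {x \<in> H. comm x g \<in> L2}" if g: "g \<in> H" for g
    using comm_pow_L2 g subgroup_pow_closed[OF H] NH ZN comm_Z[OF _ Hc[OF g]]
      subgroup.one_closed[OF L2'] by auto
  then have "P \<subseteq> {x \<in> H. comm x g \<in> L2}" if "g \<in> H" for g
    unfolding P_def agemo_def
    using generate_subgroup_incl subgroup_comm_mod[OF L2(1)] that by meson
  then have "gens P \<subseteq> L2" using L2(3) unfolding gens_def by blast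
  \<comment> \<open>Together with the reverse inclusion, \<open>L1\<close> equals
    \<open>M [L1, H]\<close>: modulo \<open>M\<close> it no longer shrinks under commutation with
    \<open>H\<close>.\<close>
  then have L12: "L1 \<subseteq> L2"
    unfolding L1_def step_def by (rule generate_subgroup_incl[OF _ L2'])
  define E where "E k = {l \<in> L1. \<exists>m\<in>M. inv m \<otimes> l \<in> upper_central k}" for k
  \<comment> \<open>If \<open>L1\<close> agrees with \<open>M\<close> modulo one term of the series,
    then its commutators with \<open>H\<close> agree with commutators of \<open>M\<close>, hence
    with elements of \<open>M\<close>, modulo the next smaller term.\<close>
  have descend: "L1 \<subseteq> E k" if hyp: "L1 \<subseteq> E (Suc k)" for k
  proof -
    have one: "\<one> \<in> upper_central i" for i
      using normal_in_upper_central[of i] subgroup.one_closed by (auto simp: normal_in_def)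
    have "gens L1 \<subseteq> E k"
    proof
      fix y assume "y \<in> gens L1"
      then consider "y \<in> M" | l h where "y = comm l h" "l \<in> L1" "h \<in> H"
        by (auto simp: gens_def)
      then show "y \<in> E k"
      proof cases
        case 1
        then have "inv y \<otimes> y \<in> upper_central k"
          using one subgroup.mem_carrier[OF M] by simp
        then show ?thesis using 1 L1(3) by (auto simp: E_def)
      next
        case 2
        obtain m where m: "m \<in> M" "inv m \<otimes> l \<in> upper_central (Suc k)"
          using hyp 2(2) by (auto simp: E_def)
        have "inv h \<otimes> h \<in> upper_central (Suc k)" using one Hc[OF 2(3)] by simp
        then have "inv (comm m h) \<otimes> comm l h \<in> upper_central k"
          using comm_near[OF _ _ m(2)] Hc[OF 2(3)] subgroup.mem_carrier[OF M m(1)]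
            subgroup.mem_carrier[OF L1' 2(2)] by blast
        moreover have "comm m h \<in> M" using normal_in_comm[OF norM m(1) 2(3)] by simp
        moreover have "comm l h \<in> L1" using normal_in_comm[OF L1(1) 2(2,3)] by simp
        ultimately show ?thesis using 2(1) by (auto simp: E_def)
      qed
    qed
    moreover have "subgroup (E k) G"
      unfolding E_def by (rule subgroup_near[OF L1' M normal_in_upper_central])
    ultimately have "L2 \<subseteq> E k" unfolding L2_def step_def by (rule generate_subgroup_incl)
    then show ?thesis using L12 by blast
  qed
  obtain c where c: "upper_central c = carrier G" using nilpotent .
  have "L1 \<subseteq> E c"
    using subgroup.one_closed[OF M] subgroup.mem_carrier[OF L1'] by (auto simp: E_def c)
  then have "L1 \<subseteq> E 0" by (induction c) (use descend in auto)
  moreover have "E 0 \<subseteq> M"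
  proof
    fix a assume "a \<in> E 0"
    then obtain b where b: "a \<in> L1" "b \<in> M" "inv b \<otimes> a = \<one>" by (auto simp: E_def)
    then have "a = b"
      using subgroup.mem_carrier[OF M] subgroup.mem_carrier[OF L1'] inv_equality[of "inv b" a]
      by force
    then show "a \<in> M" using b by simp
  qed
  ultimately have "L1 \<subseteq> M" by blast
  then have "comm x h \<in> M" if "x \<in> P" "h \<in> H" for x h using comm_P[OF that] by blast
  then show ?thesis
    using norP ZP by (simp add: powerfully_embedded_def M_def P_def)
qed

lemma powerfully_embedded_subset:
  assumes "powerfully_embedded N H" "subgroup K G" "N \<subseteq> K" "K \<subseteq> H"
  shows "powerfully_embedded N K"
  using assms normal_in_subset unfolding powerfully_embedded_def by blast

lemma powerfully_embedded_agemo_iter: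
  "powerfully_embedded N H \<Longrightarrow> powerfully_embedded ((agemo ^^ k) N) H"
  by (induction k) (simp_all add: powerfully_embedded_agemo)

text \<open>The commutator of \<open>h\<close> and \<open>a\<close> lies in \<open>agemo N\<close>,
  so its \<open>p\<close>-th power and, as \<open>agemo N\<close> is again powerfully embedded, its
  commutators with \<open>H\<close> lie in \<open>agemo (agemo N)\<close>.\<close>

lemma pow_mult_agemo:
  assumes "powerfully_embedded N H" "h \<in> H" "a \<in> N"
  obtains m where "m \<in> agemo (agemo N)" "(h \<otimes> a) [^] p = h [^] p \<otimes> a [^] p \<otimes> m"
proof -
  note * = powerfully_embedded_agemo[OF assms(1)]
  have norN: "normal_in N H" using assms(1) by (simp add: powerfully_embedded_def)
  then have NH: "N \<subseteq> H" and H: "subgroup H G" by (auto simp: normal_in_def)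
  have norM: "normal_in (agemo (agemo N)) H"
    using powerfully_embedded_agemo[OF *] by (simp add: powerfully_embedded_def)
  have P: "subgroup (agemo N) G" using * by (simp add: powerfully_embedded_def normal_in_def)
  have "comm a h \<in> agemo N" using assms by (simp add: powerfully_embedded_def)
  then have c: "comm h a \<in> agemo N"
    using comm_swap[OF P] assms NH subgroup.mem_carrier[OF H] by blast
  then have "comm (comm h a) g \<in> agemo (agemo N)" if "g \<in> H" for g
    using * that by (simp add: powerfully_embedded_def)
  then show thesis
    using pow_mult_mod[OF norM prime odd assms(2), of a] pow_in_agemo[OF c] assms NH that by blast
qed

text \<open>Modulo \<open>agemo (agemo N)\<close> a product of \<open>p\<close>-th powers is the
  \<open>p\<close>-th power of the product, so the \<open>p\<close>-th powers already form a
  subgroup there.\<close>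

lemma agemo_eq_pow_mod:
  assumes "powerfully_embedded N N" "x \<in> agemo N"
  obtains a m where "a \<in> N" "m \<in> agemo (agemo N)" "x = a [^] p \<otimes> m"
proof -
  define M where "M = agemo (agemo N)"
  have norM: "normal_in M N"
    using powerfully_embedded_agemo[OF powerfully_embedded_agemo[OF assms(1)]]
    by (simp add: powerfully_embedded_def M_def)
  then have M: "subgroup M G" and N: "subgroup N G" by (auto simp: normal_in_def)
  have Nc: "a \<in> carrier G" if "a \<in> N" for a using that subgroup.mem_carrier[OF N] by blast
  have Mc: "a \<in> carrier G" if "a \<in> M" for a using that subgroup.mem_carrier[OF M] by blast
  have ZM: "Z \<subseteq> M" by (simp add: M_def Z_subset_agemo)
  have "\<exists>a\<in>N. \<exists>m\<in>M. x = a [^] p \<otimes> m"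
    using assms(2) unfolding agemo_def
  proof (induction rule: generate.induct)
    case one
    show ?case using subgroup.one_closed[OF M] subgroup.one_closed[OF N]
      by (intro bexI[of _ \<one>]) simp_all
  next
    case (incl s)
    then show ?case
    proof
      assume "s \<in> Z"
      then show ?thesis using ZM Mc subgroup.one_closed[OF N]
        by (intro bexI[of _ \<one>] bexI[of _ s]) auto
    next
      assume "s \<in> {x [^] p | x. x \<in> N}"
      then obtain a where "a \<in> N" "s = a [^] p" by blast
      then show ?thesis using subgroup.one_closed[OF M] Nc
        by (intro bexI[of _ a] bexI[of _ \<one>]) simp_all
    qed
  next
    case (inv s)
    then show ?case
    proof
      assume "s \<in> Z"
      then have "inv s \<in> Z" by (rule subgroup.m_inv_closed[OF subgroup_Z])
      then show ?thesis using ZM Mc subgroup.one_closed[OF N]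
        by (intro bexI[of _ \<one>] bexI[of _ "inv s"]) auto
    next
      assume "s \<in> {x [^] p | x. x \<in> N}"
      then obtain a where "a \<in> N" "s = a [^] p" by blast
      then show ?thesis
        using subgroup.one_closed[OF M] subgroup.m_inv_closed[OF N] Nc
        by (intro bexI[of _ "inv a"] bexI[of _ \<one>]) (simp_all add: nat_pow_inv)
    qed
  next
    case (eng x y)
    obtain a m b m' where *: "a \<in> N" "m \<in> M" "x = a [^] p \<otimes> m" "b \<in> N" "m' \<in> M" "y = b [^] p \<otimes> m'"
      using eng by blast
    obtain m'' where m'': "m'' \<in> M" "(a \<otimes> b) [^] p = a [^] p \<otimes> b [^] p \<otimes> m''"
      using pow_mult_agemo[OF assms(1) *(1,4)] unfolding M_def by blast
    \<comment> \<open>Conjugation moves the error term \<open>m\<close> of \<open>x\<close> to the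
      right past \<open>b [^] p\<close>.\<close>
    define t where "t = inv (b [^] p) \<otimes> m \<otimes> b [^] p"
    have t: "t \<in> M"
      using norM *(2) subgroup_pow_closed[OF N *(4)] by (simp add: normal_in_def t_def)
    have "inv m'' \<otimes> (t \<otimes> m') \<in> M"
      using subgroup.m_closed[OF M] subgroup.m_inv_closed[OF M] m''(1) t *(5) by simp
    moreover have "x \<otimes> y = (a \<otimes> b) [^] p \<otimes> (inv m'' \<otimes> (t \<otimes> m'))"
      unfolding m''(2) *(3,6) t_def using * m''(1) Nc Mc by (simp add: m_assoc)
    moreover have "a \<otimes> b \<in> N" using subgroup.m_closed[OF N] * by simp
    ultimately show ?case by blast
  qed
  then show thesis using that by (auto simp: M_def)
qed

text \<open>If one iterate equals the next, it is generated by \<open>Z\<close> and its own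
  \<open>p\<close>-th powers, so \<open>frattini\<close> identifies it with \<open>Z\<close>.
  Otherwise the cardinalities would decrease forever.\<close>

lemma agemo_iter_eq_Z:
  assumes "powerfully_embedded N N"
  obtains k where "k > 0" "(agemo ^^ k) N = Z"
proof (rule ccontr)
  assume "\<not> thesis"
  then have ne: "(agemo ^^ Suc k) N \<noteq> Z" for k using that by blast
  define P where "P k = (agemo ^^ k) N" for k
  have P: "subgroup (P k) G" "Z \<subseteq> P k" for k
    using powerfully_embedded_agemo_iter[OF assms, of k]
    by (auto simp: powerfully_embedded_def normal_in_def P_def)
  have fin: "finite (P k)" for k
    using subgroup.subset[OF P(1)] finite_carrier finite_subset by blast
  have PSuc: "P (Suc k) = agemo (P k)" for k by (simp add: P_def)
  have less: "card (P (Suc k)) < card (P k)" for k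
  proof -
    have sub: "P (Suc k) \<subseteq> P k" unfolding PSuc using agemo_subset[OF P] .
    have "P (Suc k) \<noteq> P k"
    proof
      assume "P (Suc k) = P k"
      then have "P k \<subseteq> generate G (Z \<union> {a [^] p | a. a \<in> P k})"
        unfolding PSuc agemo_def by (simp add: Un_commute)
      then have "P k = Z" using frattini[OF P(1) subgroup_Z P(2)] by blast
      then show False using ne[of k] \<open>P (Suc k) = P k\<close> by (simp add: P_def)
    qed
    then show ?thesis using sub fin by (simp add: psubset_card_mono psubsetI)
  qed
  have "card (P k) + k \<le> card (P 0)" for k
  proof (induction k)
    case (Suc k)
    then show ?case using less[of k] by linarith
  qed simp
  from this[of "Suc (card (P 0))"] show False by simp
qed

text \<open>An approximate \<open>p\<close>-th root modulo \<open>(agemo ^^ k) N\<close> is improved step by step.\<close>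

lemma agemo_eq_pow:
  assumes "powerfully_embedded N N" "g \<in> agemo N"
  obtains h z where "h \<in> N" "z \<in> Z" "g = h [^] p \<otimes> z"
proof -
  define P where "P k = (agemo ^^ k) N" for k
  have PSuc: "P (Suc k) = agemo (P k)" for k by (simp add: P_def)
  have pe: "powerfully_embedded (P k) N" for k
    unfolding P_def by (rule powerfully_embedded_agemo_iter[OF assms(1)])
  have N: "subgroup N G" using assms(1) by (simp add: powerfully_embedded_def normal_in_def)
  have P: "subgroup (P k) G" "P k \<subseteq> N" for k
    using pe[of k] by (auto simp: powerfully_embedded_def normal_in_def)
  have Nc: "a \<in> carrier G" if "a \<in> N" for a using that subgroup.mem_carrier[OF N] by blast
  have approx: "\<exists>h\<in>N. \<exists>m\<in>P (Suc k). g = h [^] p \<otimes> m" for k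
  proof (induction k)
    \<comment> \<open>The first approximate root is \<open>\<one>\<close>, with \<open>g\<close>
      itself as the error.\<close>
    case 0
    have "g \<in> P 1" using assms(2) by (simp add: P_def)
    then show ?case using subgroup.one_closed[OF N] P[of 1] Nc
      by (intro bexI[of _ \<one>] bexI[of _ g]) auto
  next
    case (Suc k)
    then obtain h m where h: "h \<in> N" "m \<in> P (Suc k)" "g = h [^] p \<otimes> m" by blast
    have "powerfully_embedded (P k) (P k)"
      using powerfully_embedded_subset[OF pe P(1)] P(2) by blast
    \<comment> \<open>The error is a \<open>p\<close>-th power up to a finer error; its root
      \<open>a\<close> is absorbed into the new approximation \<open>h \<otimes> a\<close>.\<close>
    then obtain a m' where a: "a \<in> P k" "m' \<in> P (Suc (Suc k))" "m = a [^] p \<otimes> m'"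
      using agemo_eq_pow_mod h(2) unfolding PSuc by blast
    obtain m'' where m'': "m'' \<in> P (Suc (Suc k))" "(h \<otimes> a) [^] p = h [^] p \<otimes> a [^] p \<otimes> m''"
      using pow_mult_agemo[OF pe h(1) a(1)] unfolding PSuc by blast
    have c: "a \<in> carrier G" "h \<in> carrier G" "m' \<in> carrier G" "m'' \<in> carrier G"
      using Nc P(2) a h(1) m'' by blast+
    have "inv m'' \<otimes> m' \<in> P (Suc (Suc k))"
      using subgroup.m_closed[OF P(1)] subgroup.m_inv_closed[OF P(1)] m''(1) a(2) by blast
    moreover have "g = (h \<otimes> a) [^] p \<otimes> (inv m'' \<otimes> m')"
      unfolding m''(2) h(3) a(3) using c by (simp add: m_assoc)
    moreover have "h \<otimes> a \<in> N" using subgroup.m_closed[OF N h(1)] a(1) P(2) by blast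
    ultimately show ?case by blast
  qed
  \<comment> \<open>The approximation with index \<open>k - 1\<close> has its error in
    \<open>P k = Z\<close>; positivity of \<open>k\<close> makes this index correct.\<close>
  obtain k where "k > 0" "P k = Z" using agemo_iter_eq_Z[OF assms(1)] unfolding P_def .
  then show thesis using approx[of "k - 1"] that by auto
qed

section \<open>Iterated p-th powers up to central factors\<close>

lemma pow_mult_Z:
  fixes k :: nat
  assumes "x \<in> carrier G" "z \<in> Z"
  shows "(x \<otimes> z) [^] k = x [^] k \<otimes> z [^] k"
  using assms Z_carrier Z_central by (intro pow_mult_distrib) auto

lemma Z_pow: "z \<in> Z \<Longrightarrow> z [^] (k::nat) \<in> Z"
  by (rule subgroup_pow_closed[OF subgroup_Z])

text \<open>Each iterate is powerfully embedded in itself, so \<open>agemo_eq_pow\<close> extracts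
  one \<open>p\<close>-th root at a time. Central factors are collected on the right.\<close>

lemma agemo_iter_eq_pow:
  assumes "powerfully_embedded N N" "g \<in> (agemo ^^ k) N"
  obtains h z where "h \<in> N" "z \<in> Z" "g = h [^] (p ^ k) \<otimes> z"
proof -
  have N: "subgroup N G" using assms(1) by (simp add: powerfully_embedded_def normal_in_def)
  have "\<exists>h\<in>N. \<exists>z\<in>Z. g = h [^] (p ^ k) \<otimes> z"
    using assms(2)
  proof (induction k arbitrary: g)
    case 0
    then show ?case
      using subgroup.one_closed[OF subgroup_Z] subgroup.mem_carrier[OF N]
      by (intro bexI[of _ g] bexI[of _ \<one>]) auto
  next
    case (Suc k)
    have pe: "powerfully_embedded ((agemo ^^ k) N) N"
      by (rule powerfully_embedded_agemo_iter[OF assms(1)])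
    then have "powerfully_embedded ((agemo ^^ k) N) ((agemo ^^ k) N)"
      by (rule powerfully_embedded_subset)
        (use pe in \<open>auto simp: powerfully_embedded_def normal_in_def\<close>)
    then obtain x z where x: "x \<in> (agemo ^^ k) N" "z \<in> Z" "g = x [^] p \<otimes> z"
      using agemo_eq_pow[of "(agemo ^^ k) N" g] Suc(2) by auto
    obtain h z' where h: "h \<in> N" "z' \<in> Z" "x = h [^] (p ^ k) \<otimes> z'" using Suc(1)[OF x(1)] by blast
    have hc: "h \<in> carrier G" using subgroup.mem_carrier[OF N h(1)] .
    have "g = h [^] (p ^ Suc k) \<otimes> (z' [^] p \<otimes> z)"
      unfolding x(3) h(3) using hc h(2) x(2) Z_carrier
      by (simp add: pow_mult_Z nat_pow_pow m_assoc mult.commute)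
    moreover have "z' [^] p \<otimes> z \<in> Z" using subgroup.m_closed[OF subgroup_Z] Z_pow h x by simp
    ultimately show ?case using h(1) by blast
  qed
  then show thesis using that by blast
qed

lemma pow_in_agemo_iter:
  assumes "subgroup H G" "x \<in> H"
  shows "x [^] (p ^ k) \<in> (agemo ^^ k) H"
proof (induction k)
  case 0
  then show ?case using assms subgroup.mem_carrier by force
next
  case (Suc k)
  then have "(x [^] (p ^ k)) [^] p \<in> agemo ((agemo ^^ k) H)" by (rule pow_in_agemo)
  then show ?case using subgroup.mem_carrier[OF assms]
    by (simp add: nat_pow_pow mult.commute)
qed

section \<open>Subgroups generated by one element and the p-th powers\<close>

definition adjoin :: "'a \<Rightarrow> 'a set \<Rightarrow> 'a set" where
  "adjoin u H = generate G (insert u (agemo H))"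

lemma adjoin_mem: "u \<in> adjoin u H" "agemo H \<subseteq> adjoin u H"
  unfolding adjoin_def by (auto intro: generate.incl)

text \<open>Commutators of generators lie in \<open>agemo (agemo H)\<close>: at least one entry is
  in the powerfully embedded \<open>agemo H\<close>, or both are \<open>u\<close>. That subgroup is
  contained in \<open>agemo (adjoin u H)\<close>.\<close>

lemma adjoin:
  assumes pe: "powerfully_embedded H H" and u: "u \<in> H"
  shows "adjoin u H \<subseteq> H" "powerfully_embedded (adjoin u H) (adjoin u H)"
proof -
  have H: "subgroup H G" and ZH: "Z \<subseteq> H"
    using pe by (auto simp: powerfully_embedded_def normal_in_def)
  have Hc: "a \<in> carrier G" if "a \<in> H" for a using that subgroup.mem_carrier[OF H] by blast
  have sub: "insert u (agemo H) \<subseteq> H" using agemo_subset[OF H ZH] u by blast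
  then show KH: "adjoin u H \<subseteq> H" unfolding adjoin_def by (rule generate_subgroup_incl[OF _ H])
  have "insert u (agemo H) \<subseteq> carrier G" using sub Hc by blast
  then have K: "subgroup (adjoin u H) G" unfolding adjoin_def by (rule generate_is_subgroup)
  define M where "M = agemo (agemo H)"
  note * = powerfully_embedded_agemo[OF pe]
  have norM: "normal_in M H"
    using powerfully_embedded_agemo[OF *] by (simp add: powerfully_embedded_def M_def)
  then have M: "subgroup M G" by (simp add: normal_in_def)
  have "comm s t \<in> M" if s: "s \<in> insert u (agemo H)" and t: "t \<in> insert u (agemo H)" for s t
  proof -
    have PM: "comm a h \<in> M" if "a \<in> agemo H" "h \<in> H" for a h
      using * that by (simp add: powerfully_embedded_def M_def)
    consider "s \<in> agemo H" | "t \<in> agemo H" | "s = u" "t = u" using s t by blast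
    then show ?thesis
    proof cases
      case 1
      then show ?thesis using PM t sub by blast
    next
      case 2
      then show ?thesis using PM[of t s] comm_swap[OF M] s t sub Hc by blast
    next
      case 3
      then have "comm s t = \<one>" using Hc[OF u] by (simp add: comm_eq_one_iff)
      then show ?thesis using subgroup.one_closed[OF M] by simp
    qed
  qed
  then have "comm x y \<in> M" if "x \<in> adjoin u H" "y \<in> adjoin u H" for x y
    using generate_comm_mod[OF norM sub] that unfolding adjoin_def by blast
  moreover have "M \<subseteq> agemo (adjoin u H)"
    unfolding M_def by (rule agemo_mono[OF adjoin_mem(2)])
  moreover have "agemo (adjoin u H) \<subseteq> adjoin u H"
    using agemo_subset[OF K] Z_subset_agemo adjoin_mem(2) by blast
  ultimately show "powerfully_embedded (adjoin u H) (adjoin u H)"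
    unfolding powerfully_embedded_def
    using K Z_subset_agemo adjoin_mem(2) by (intro conjI ballI normal_inI) blast+
qed

text \<open>Here \<open>H\<close> is generated by \<open>u\<close>, \<open>Z\<close> and
  \<open>p\<close>-th powers. By \<open>frattini\<close>, \<open>u\<close> and the central subgroup
  \<open>Z\<close> suffice, so \<open>H\<close> is abelian. Consequently \<open>adjoin u H\<close>
  is proper when \<open>H\<close> is non-abelian.\<close>

lemma adjoin_eq_imp_commute:
  assumes pe: "powerfully_embedded H H" and u: "u \<in> H" and eq: "adjoin u H = H"
    and "x \<in> H" "y \<in> H"
  shows "comm x y = \<one>"
proof -
  have H: "subgroup H G" and ZH: "Z \<subseteq> H"
    using pe by (auto simp: powerfully_embedded_def normal_in_def)
  have Hc: "a \<in> carrier G" if "a \<in> H" for a using that subgroup.mem_carrier[OF H] by blast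
  define B where "B = generate G (insert u Z)"
  have uZ: "insert u Z \<subseteq> H" using u ZH by blast
  then have BH: "B \<subseteq> H" unfolding B_def by (rule generate_subgroup_incl[OF _ H])
  have B: "subgroup B G" unfolding B_def using uZ Hc by (intro generate_is_subgroup) blast
  let ?S = "B \<union> {a [^] p | a. a \<in> H}"
  have S: "?S \<subseteq> carrier G" using BH Hc by blast
  have "insert u Z \<subseteq> B" unfolding B_def by (auto intro: generate.incl)
  then have ZS: "{a [^] p | a. a \<in> H} \<union> Z \<subseteq> ?S" and "u \<in> ?S" by blast+
  have "agemo H \<subseteq> generate G ?S" unfolding agemo_def by (rule mono_generate[OF ZS])
  moreover have "u \<in> generate G ?S" using \<open>u \<in> ?S\<close> by (rule generate.incl)
  ultimately have "generate G (insert u (agemo H)) \<subseteq> generate G ?S"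
    by (intro generate_subgroup_incl generate_is_subgroup[OF S]) simp
  then have "H \<subseteq> generate G ?S" using eq by (simp add: adjoin_def)
  then have "H = B" by (rule frattini[OF H B BH])
  moreover have "comm s t \<in> {\<one>}" if "s \<in> insert u Z" "t \<in> insert u Z" for s t
    using that Hc[OF u] comm_Z Z_carrier by (auto simp: comm_eq_one_iff)
  moreover have "insert u Z \<subseteq> carrier G" using uZ Hc by blast
  ultimately have "comm x y \<in> {\<one>}"
    using generate_comm_mod[OF normal_in_carrier_trivial, of "insert u Z"] assms(4,5)
    unfolding B_def by blast
  then show ?thesis by simp
qed

end

section \<open>Orders of commutators\<close>

context central_p_group
begin

text \<open>Orders are measured modulo \<open>Z\<close>, but the equation holds in the group itself.
  This is how hypotheses modulo the centre yield bounds on true orders.\<close>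

definition pow_additive :: "'a set \<Rightarrow> bool" where
  "pow_additive H \<longleftrightarrow> (\<forall>i. \<forall>x\<in>H. \<forall>y\<in>H. x [^] (p ^ i) \<in> Z \<longrightarrow> y [^] (p ^ i) \<in> Z \<longrightarrow>
     (x \<otimes> y) [^] (p ^ i) = x [^] (p ^ i) \<otimes> y [^] (p ^ i))"

lemma pow_additive_subset: "pow_additive H \<Longrightarrow> K \<subseteq> H \<Longrightarrow> pow_additive K"
  unfolding pow_additive_def by blast

lemma one_Z: "\<one> \<in> Z"
  by (rule subgroup.one_closed[OF subgroup_Z])

text \<open>Since \<open>\<one>\<close> is in \<open>Z\<close>, additivity applies to elements of
  order dividing \<open>p ^ r\<close> and gives closure under products; conjugation preserves
  orders.\<close>

lemma normal_in_omega:
  assumes "pow_additive K" "normal_in K H"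
  shows "normal_in {h \<in> K. h [^] (p ^ r) = \<one>} H"
proof -
  have K: "subgroup K G" and H: "subgroup H G" and KH: "K \<subseteq> H"
    using assms(2) by (auto simp: normal_in_def)
  have Kc: "a \<in> carrier G" if "a \<in> K" for a using that subgroup.mem_carrier[OF K] by blast
  have Hc: "a \<in> carrier G" if "a \<in> H" for a using that subgroup.mem_carrier[OF H] by blast
  have "subgroup {h \<in> K. h [^] (p ^ r) = \<one>} G"
  proof (rule subgroupI)
    show "{h \<in> K. h [^] (p ^ r) = \<one>} \<noteq> {}" using subgroup.one_closed[OF K] by force
    show "a \<otimes> b \<in> {h \<in> K. h [^] (p ^ r) = \<one>}"
      if "a \<in> {h \<in> K. h [^] (p ^ r) = \<one>}" "b \<in> {h \<in> K. h [^] (p ^ r) = \<one>}" for a b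
      using that assms(1) subgroup.m_closed[OF K] one_Z unfolding pow_additive_def by auto
  qed (use Kc subgroup.m_inv_closed[OF K] in \<open>auto simp: nat_pow_inv\<close>)
  moreover have "(inv h \<otimes> x \<otimes> h) [^] (p ^ r) = \<one>"
    if "h \<in> H" "x \<in> K" "x [^] (p ^ r) = \<one>" for h x
    using conj_pow[OF Kc[OF that(2)] Hc[OF that(1)], of "p ^ r"] that Hc[OF that(1)] by simp
  ultimately show ?thesis
    using assms(2) unfolding normal_in_def by auto
qed

text \<open>The commutator is the product of \<open>y\<close> and a conjugate \<open>y'\<close> of
  its inverse, both in \<open>adjoin y H\<close>. Their \<open>p ^ i\<close>-th powers are mutually
  inverse central elements, and additivity multiplies them.\<close>

lemma comm_pow_eq_one:
  assumes pe: "powerfully_embedded H H" and K: "pow_additive (adjoin y H)"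
    and xy: "x \<in> H" "y \<in> H" and yZ: "y [^] (p ^ i) \<in> Z"
  shows "comm x y [^] (p ^ i) = \<one>"
proof -
  have H: "subgroup H G" using pe by (simp add: powerfully_embedded_def normal_in_def)
  have c: "x \<in> carrier G" "y \<in> carrier G" using xy subgroup.mem_carrier[OF H] by auto
  have Ksub: "subgroup (adjoin y H) G"
    using adjoin(2)[OF pe xy(2)] by (simp add: powerfully_embedded_def normal_in_def)
  define y' where "y' = inv x \<otimes> inv y \<otimes> x"
  have y'c: "y' \<in> carrier G" using c by (simp add: y'_def)
  have "comm x y \<in> agemo H" using pe xy by (simp add: powerfully_embedded_def)
  then have "comm x y \<otimes> inv y \<in> adjoin y H"
    using adjoin_mem subgroup.m_closed[OF Ksub] subgroup.m_inv_closed[OF Ksub] by blast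
  moreover have "comm x y \<otimes> inv y = y'" using c by (simp add: commutator_def y'_def m_assoc)
  ultimately have y'K: "y' \<in> adjoin y H" by simp
  have "y' [^] (p ^ i) = inv x \<otimes> inv (y [^] (p ^ i)) \<otimes> x"
    using conj_pow[of "inv y" x "p ^ i"] c by (simp add: y'_def nat_pow_inv)
  also have "\<dots> = inv (y [^] (p ^ i))"
    using Z_central[OF subgroup.m_inv_closed[OF subgroup_Z yZ] c(1)] c by (simp add: m_assoc)
  finally have y'p: "y' [^] (p ^ i) = inv (y [^] (p ^ i))" .
  have "comm x y = y' \<otimes> y" using c by (simp add: commutator_def y'_def m_assoc)
  then show ?thesis
    using K y'K adjoin_mem(1) y'p yZ subgroup.m_inv_closed[OF subgroup_Z yZ] c
    unfolding pow_additive_def by simp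
qed

text \<open>Replacing \<open>u\<close> by its \<open>p\<close>-th power lowers the order bound of
  the commutator by one factor \<open>p\<close>. Modulo the elements of \<open>adjoin u H\<close> of
  order dividing \<open>p ^ m\<close>, collection makes the new commutator congruent to
  \<open>comm u v [^] p\<close>, which is trivial there. The premise \<open>hyp\<close> is the
  commutator bound one level higher and controls the triple commutators.\<close>

lemma comm_pow_step:
  assumes pe: "powerfully_embedded H H" and K: "\<And>u. u \<in> H \<Longrightarrow> pow_additive (adjoin u H)"
    and uv: "u \<in> H" "v \<in> H" and c_in: "comm u v \<in> (agemo ^^ Suc r) H"
    and cp: "comm u v [^] (p ^ Suc m) = \<one>" and up: "u [^] (p ^ (m + r + 2)) \<in> Z"
    and hyp: "\<And>g w. g \<in> H \<Longrightarrow> w \<in> H \<Longrightarrow> g [^] (p ^ (m + r + 3)) \<in> Z \<Longrightarrow>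
      w [^] (p ^ (m + r + 2)) \<in> Z \<Longrightarrow> comm (g [^] (p ^ (r + 2))) w [^] (p ^ m) = \<one>"
  shows "comm (u [^] p) v [^] (p ^ m) = \<one>"
proof -
  have H: "subgroup H G" using pe by (simp add: powerfully_embedded_def normal_in_def)
  have Hc: "a \<in> carrier G" if "a \<in> H" for a using that subgroup.mem_carrier[OF H] by blast
  define c where "c = comm u v"
  define e where "e = comm u c"
  define \<Omega> where "\<Omega> = {h \<in> adjoin u H. h [^] (p ^ m) = \<one>}"
  have K': "subgroup (adjoin u H) G" and norK: "normal_in (adjoin u H) (adjoin u H)"
    using adjoin(2)[OF pe uv(1)] by (auto simp: powerfully_embedded_def normal_in_def)
  have norO: "normal_in \<Omega> (adjoin u H)"
    unfolding \<Omega>_def by (rule normal_in_omega[OF K[OF uv(1)] norK])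
  then have \<Omega>: "subgroup \<Omega> G" by (simp add: normal_in_def)
  have uK: "u \<in> adjoin u H" by (rule adjoin_mem)
  have cH: "c \<in> H" unfolding c_def using subgroup_comm_closed[OF H uv] .
  have "c \<in> agemo H" using pe uv by (simp add: powerfully_embedded_def c_def)
  then have cK: "c \<in> adjoin u H" using adjoin_mem(2) by blast
  have eK: "e \<in> adjoin u H" unfolding e_def using subgroup_comm_closed[OF K' uK cK] .
  have eH: "e \<in> H" unfolding e_def using subgroup_comm_closed[OF H uv(1) cH] .
  note car = Hc[OF uv(1)] Hc[OF uv(2)] Hc[OF cH] Hc[OF eH]
  have cp': "c [^] (p ^ Suc m) = \<one>" using cp by (simp add: c_def)
  then have ep: "e [^] (p ^ Suc m) = \<one>"
    unfolding e_def by (intro comm_pow_eq_one[OF pe K[OF cH] uv(1) cH]) (simp only: one_Z)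
  \<comment> \<open>One more commutator goes one \<open>agemo\<close> deeper, which lets
    \<open>e\<close> be written as a \<open>p ^ (r + 2)\<close>-th power up to
    \<open>Z\<close>.\<close>
  have "comm c u \<in> agemo ((agemo ^^ Suc r) H)"
    using powerfully_embedded_agemo_iter[OF pe, of "Suc r"] c_in uv(1)
    unfolding powerfully_embedded_def c_def by blast
  then have "comm c u \<in> (agemo ^^ (r + 2)) H" by simp
  moreover have "subgroup ((agemo ^^ (r + 2)) H) G"
    using powerfully_embedded_agemo_iter[OF pe, of "r + 2"]
    unfolding powerfully_embedded_def normal_in_def by blast
  ultimately have "e \<in> (agemo ^^ (r + 2)) H"
    unfolding e_def using comm_swap car by blast
  then obtain g z where g: "g \<in> H" "z \<in> Z" "e = g [^] (p ^ (r + 2)) \<otimes> z"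
    using agemo_iter_eq_pow[OF pe] by blast
  define q where "q = g [^] (p ^ (r + 2))"
  have gc: "g \<in> carrier G" and qc: "q \<in> carrier G" using Hc[OF g(1)] by (auto simp: q_def)
  \<comment> \<open>As \<open>e = q \<otimes> z\<close> has trivial \<open>p ^ Suc m\<close>-th
    power, the same power of \<open>q\<close> lies in \<open>Z\<close>; so \<open>g\<close> meets
    the order condition of \<open>hyp\<close>.\<close>
  have "q [^] (p ^ Suc m) \<otimes> z [^] (p ^ Suc m) = \<one>"
    using pow_mult_Z[OF qc g(2), of "p ^ Suc m"] ep g(3) by (simp add: q_def)
  then have "q [^] (p ^ Suc m) = inv (z [^] (p ^ Suc m))"
    using qc Z_carrier[OF g(2)] inv_equality by simp
  moreover have "p ^ (r + 2) * p ^ Suc m = p ^ (m + r + 3)"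
    by (simp add: power_add eval_nat_numeral)
  ultimately have "g [^] (p ^ (m + r + 3)) = inv (z [^] (p ^ Suc m))"
    using gc unfolding q_def by (simp only: nat_pow_pow)
  then have gp: "g [^] (p ^ (m + r + 3)) \<in> Z"
    using subgroup.m_inv_closed[OF subgroup_Z Z_pow[OF g(2)]] by simp
  \<comment> \<open>The central factor \<open>z\<close> drops out, and \<open>hyp\<close> bounds the
    commutator of \<open>q\<close>. This is used for \<open>w = c\<close> and
    \<open>w = u\<close>.\<close>
  have ew: "comm e w [^] (p ^ m) = \<one>" if w: "w \<in> H" "w [^] (p ^ (m + r + 2)) \<in> Z" for w
  proof -
    have "comm e w = comm q w"
      unfolding g(3) q_def[symmetric]
      by (rule comm_mult_central(1)[OF qc Hc[OF w(1)] Z_carrier[OF g(2)] Z_central[OF g(2)]])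
    then show ?thesis using hyp[OF g(1) w(1) gp w(2)] by (simp add: q_def)
  qed
  have "p ^ (m + r + 2) = p ^ Suc m * p ^ (r + 1)" by (simp add: power_add)
  then have "c [^] (p ^ (m + r + 2)) = (c [^] (p ^ Suc m)) [^] (p ^ (r + 1))"
    using car by (simp only: nat_pow_pow)
  then have "c [^] (p ^ (m + r + 2)) \<in> Z" using cp' one_Z by simp
  then have "comm e c \<in> \<Omega>" "comm e u \<in> \<Omega>"
    using ew[OF cH] ew[OF uv(1) up] subgroup_comm_closed[OF K' eK] uK cK by (auto simp: \<Omega>_def)
  moreover have "e [^] p \<in> \<Omega>" and cpO: "c [^] p \<in> \<Omega>"
    using ep cp' car subgroup_pow_closed[OF K'] eK cK by (auto simp: \<Omega>_def nat_pow_pow)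
  ultimately obtain t where t: "t \<in> \<Omega>" "(u \<otimes> c) [^] p = u [^] p \<otimes> c [^] p \<otimes> t"
    using pow_mult_mod[OF norO prime odd uK cK] unfolding e_def by blast
  have tc: "t \<in> carrier G" using subgroup.mem_carrier[OF \<Omega> t(1)] .
  have "comm (u [^] p) v = c [^] p \<otimes> t"
    using comm_pow_left[OF car(1,2), of p] t(2) car tc by (simp add: m_assoc flip: c_def)
  then have "comm (u [^] p) v \<in> \<Omega>" using subgroup.m_closed[OF \<Omega> cpO t(1)] by simp
  then show ?thesis by (simp add: \<Omega>_def)
qed

lemma comm_in_agemo_iter:
  assumes "powerfully_embedded H H" "x \<in> H" "y \<in> H"
  shows "comm (x [^] (p ^ j)) y \<in> (agemo ^^ Suc j) H"
  using powerfully_embedded_agemo_iter[OF assms(1), of j] assms pow_in_agemo_iter[of H x j]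
  by (simp add: powerfully_embedded_def normal_in_def)

text \<open>Downward induction on \<open>i\<close>: the step for \<open>i\<close> uses the bound for \<open>i + 1\<close>, and for
  \<open>i \<ge> 2 * n\<close> the bound is trivial.\<close>

lemma comm_pow_left_bound:
  assumes pe: "powerfully_embedded H H" and K: "\<And>u. u \<in> H \<Longrightarrow> pow_additive (adjoin u H)"
    and "x \<in> H" "y \<in> H" "x [^] (p ^ (i + 1)) \<in> Z" "y [^] (p ^ i) \<in> Z" "j \<le> i"
  shows "comm (x [^] (p ^ j)) y [^] (p ^ (i - j)) = \<one>"
  using assms(3-)
proof (induction "2 * n - i" arbitrary: i j x y rule: less_induct)
  case less
  have H: "subgroup H G" using pe by (simp add: powerfully_embedded_def normal_in_def)
  have xc: "x \<in> carrier G" and yc: "y \<in> carrier G"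
    using less.prems subgroup.mem_carrier[OF H] by auto
  show ?case
  proof (cases "i \<ge> 2 * n")
    case True
    \<comment> \<open>Either the power of \<open>x\<close> or the final power of the commutator is
      killed by the exponent \<open>p ^ n\<close>.\<close>
    then consider "n \<le> j" | "n \<le> i - j" by linarith
    then show ?thesis
    proof cases
      case 1
      then have "x [^] (p ^ j) = \<one>" using pow_exponent xc by simp
      then show ?thesis using yc by (simp add: commutator_def)
    next
      case 2
      then show ?thesis using pow_exponent xc yc by simp
    qed
  next
    case False
    show ?thesis
      using less.prems(5)
    proof (induction j)
      \<comment> \<open>With no power taken, this is the bound from additivity on
        \<open>adjoin y H\<close>.\<close>
      case 0
      then show ?case using comm_pow_eq_one[OF pe K less.prems(1,2,4)] less.prems xc by simp
    next
      case (Suc j)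
      define m where "m = i - Suc j"
      have i: "i = m + j + 1" using Suc.prems by (simp add: m_def)
      have u: "x [^] (p ^ j) \<in> H" using subgroup_pow_closed[OF H less.prems(1)] .
      have "comm (x [^] (p ^ j)) y [^] (p ^ Suc m) = \<one>"
        using Suc.IH by (simp add: i)
      moreover have "(x [^] (p ^ j)) [^] (p ^ (m + j + 2)) \<in> Z"
      proof -
        have "(x [^] (p ^ j)) [^] (p ^ (m + j + 2)) = (x [^] (p ^ (i + 1))) [^] (p ^ j)"
          using xc by (simp add: nat_pow_pow i mult.commute)
        then show ?thesis using Z_pow[OF less.prems(3)] by simp
      qed
      \<comment> \<open>The outer induction at level \<open>i + 1\<close> with exponent
        \<open>j + 2\<close>: the difference is again \<open>m\<close>, because
        \<open>i = m + j + 1\<close>.\<close>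
      moreover have "comm (g [^] (p ^ (j + 2))) w [^] (p ^ m) = \<one>"
        if "g \<in> H" "w \<in> H" "g [^] (p ^ (m + j + 3)) \<in> Z" "w [^] (p ^ (m + j + 2)) \<in> Z" for g w
        using less.hyps[of "i + 1" g w "j + 2"] that False
        by (simp add: i numeral_3_eq_3)
      ultimately have "comm ((x [^] (p ^ j)) [^] p) y [^] (p ^ m) = \<one>"
        by (intro comm_pow_step[OF pe K u less.prems(2) comm_in_agemo_iter[OF pe less.prems(1,2)]])
      then show ?case using xc by (simp add: nat_pow_pow mult.commute m_def)
    qed
  qed
qed

text \<open>Powers of the second entry are taken by the same \<open>comm_pow_step\<close> with the
  entries swapped. The commutator is deep enough because the other entry is already a
  \<open>p ^ j\<close>-th power.\<close>

lemma comm_pow_bound: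
  assumes pe: "powerfully_embedded H H" and K: "\<And>u. u \<in> H \<Longrightarrow> pow_additive (adjoin u H)"
    and xy: "x \<in> H" "y \<in> H" and xp: "x [^] (p ^ (i + 1)) \<in> Z" and yp: "y [^] (p ^ i) \<in> Z"
    and "j + k \<le> i"
  shows "comm (x [^] (p ^ j)) (y [^] (p ^ k)) [^] (p ^ (i - j - k)) = \<one>"
  using assms(7)
proof (induction k)
  have H: "subgroup H G" using pe by (simp add: powerfully_embedded_def normal_in_def)
  have xc: "x \<in> carrier G" and yc: "y \<in> carrier G" using xy subgroup.mem_carrier[OF H] by auto
  {
    case 0
    then show ?case using comm_pow_left_bound[OF pe K xy xp yp, of j] yc by simp
  next
    case (Suc k)
    define m where "m = i - j - Suc k"
    have i: "i = m + j + k + 1" using Suc.prems by (simp add: m_def)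
    define u v where "u = y [^] (p ^ k)" and "v = x [^] (p ^ j)"
    have uv: "u \<in> H" "v \<in> H" using subgroup_pow_closed[OF H] xy by (auto simp: u_def v_def)
    then have uvc: "u \<in> carrier G" "v \<in> carrier G" using subgroup.mem_carrier[OF H] by auto
    have A: "subgroup ((agemo ^^ Suc j) H) G"
      using powerfully_embedded_agemo_iter[OF pe, of "Suc j"]
      unfolding powerfully_embedded_def normal_in_def by blast
    have "comm u v \<in> (agemo ^^ Suc j) H"
      using comm_swap[OF A uvc(2,1)] comm_in_agemo_iter[OF pe xy(1) uv(1)] by (simp add: v_def)
    moreover have "comm u v [^] (p ^ Suc m) = \<one>"
    proof -
      have "i - j - k = Suc m" by (simp add: i)
      then have "comm v u [^] (p ^ Suc m) = \<one>" using Suc by (simp add: u_def v_def)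
      then have "inv (comm v u) [^] (p ^ Suc m) = \<one>"
        using nat_pow_inv[of "comm v u" "p ^ Suc m"] uvc by simp
      then show ?thesis using inv_comm uvc by simp
    qed
    moreover have "u [^] (p ^ (m + j + 2)) \<in> Z"
    proof -
      have "p ^ k * p ^ (m + j + 2) = p ^ i * p" by (simp add: i power_add)
      then have "u [^] (p ^ (m + j + 2)) = (y [^] (p ^ i)) [^] p"
        using yc unfolding u_def by (simp only: nat_pow_pow)
      then show ?thesis using Z_pow[OF yp] by simp
    qed
    \<comment> \<open>The one-sided bound, already available at every level, is used at level
      \<open>m + j + 2\<close>.\<close>
    moreover have "comm (g [^] (p ^ (j + 2))) w [^] (p ^ m) = \<one>"
      if "g \<in> H" "w \<in> H" "g [^] (p ^ (m + j + 3)) \<in> Z" "w [^] (p ^ (m + j + 2)) \<in> Z" for g w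
      using comm_pow_left_bound[OF pe K that(1,2), of "m + j + 2" "j + 2"] that
      by (simp add: numeral_3_eq_3)
    ultimately have "comm (u [^] p) v [^] (p ^ m) = \<one>"
      by (intro comm_pow_step[OF pe K uv, of j])
    then have "inv (comm (u [^] p) v) [^] (p ^ m) = \<one>"
      using nat_pow_inv[of "comm (u [^] p) v" "p ^ m"] uvc by simp
    then have "comm v (u [^] p) [^] (p ^ m) = \<one>" using inv_comm uvc by simp
    then show ?case using yc by (simp add: u_def v_def m_def nat_pow_pow mult.commute)
  }
qed

text \<open>If no \<open>adjoin u H\<close> is all of \<open>H\<close>, induction makes each of them
  additive, so the commutator bounds hold in \<open>H\<close>. These allow the first
  \<open>p\<close>-th power to be collected up to an error of small order in \<open>agemo H\<close>,
  where additivity handles the remaining powers.\<close>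

lemma pow_additive:
  assumes "powerfully_embedded H H"
  shows "pow_additive H"
  using assms
proof (induction "card H" arbitrary: H rule: less_induct)
  case less
  note pe = less.prems
  have norH: "normal_in H H" and H: "subgroup H G" and ZH: "Z \<subseteq> H"
    using pe by (auto simp: powerfully_embedded_def normal_in_def)
  have Hc: "a \<in> carrier G" if "a \<in> H" for a using that subgroup.mem_carrier[OF H] by blast
  show ?case
  proof (cases "\<exists>u\<in>H. adjoin u H = H")
    case True
    then have "x \<otimes> y = y \<otimes> x" if "x \<in> H" "y \<in> H" for x y
      using adjoin_eq_imp_commute[OF pe] that comm_eq_one_iff Hc by blast
    then show ?thesis
      unfolding pow_additive_def using Hc pow_mult_distrib by blast
  next
    case False
    have K: "pow_additive (adjoin u H)" if "u \<in> H" for u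
    proof -
      have "adjoin u H \<subset> H" using adjoin(1)[OF pe that] False that by blast
      moreover have "finite H" using subgroup.subset[OF H] finite_carrier finite_subset by blast
      ultimately show ?thesis
        using less.hyps adjoin(2)[OF pe that] by (simp add: psubset_card_mono)
    qed
    \<comment> \<open>Additivity is inherited from the smaller subgroup
      \<open>adjoin \<one> H\<close>.\<close>
    have agemo_add: "pow_additive (agemo H)"
      using pow_additive_subset[OF K adjoin_mem(2)] subgroup.one_closed[OF H] by blast
    have norA: "normal_in (agemo H) H" using normal_in_agemo[OF norH ZH] .
    then have A: "subgroup (agemo H) G" by (simp add: normal_in_def)
    have "(x \<otimes> y) [^] (p ^ i) = x [^] (p ^ i) \<otimes> y [^] (p ^ i)"
      if xy: "x \<in> H" "y \<in> H" and xp: "x [^] (p ^ i) \<in> Z" and yp: "y [^] (p ^ i) \<in> Z" for i x y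
    proof (cases i)
      case 0
      then show ?thesis using xy Hc by simp
    next
      case (Suc m)
      note car = Hc[OF xy(1)] Hc[OF xy(2)]
      define \<Omega> where "\<Omega> = {h \<in> agemo H. h [^] (p ^ m) = \<one>}"
      have norO: "normal_in \<Omega> H" unfolding \<Omega>_def by (rule normal_in_omega[OF agemo_add norA])
      define e where "e = comm x y"
      have eA: "e \<in> agemo H" using pe xy by (simp add: powerfully_embedded_def e_def)
      have ec: "e \<in> carrier G" using car by (simp add: e_def)
      have ep: "e [^] (p ^ i) = \<one>"
        unfolding e_def by (rule comm_pow_eq_one[OF pe K[OF xy(2)] xy yp])
      obtain g z where g: "g \<in> H" "z \<in> Z" "e = g [^] p \<otimes> z" using agemo_eq_pow[OF pe eA] .
      have gc: "g \<in> carrier G" using Hc[OF g(1)] .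
      have "(g [^] p) [^] (p ^ i) \<otimes> z [^] (p ^ i) = \<one>"
        using pow_mult_Z[of "g [^] p" z "p ^ i"] gc ep g(2,3) by simp
      then have "(g [^] p) [^] (p ^ i) = inv (z [^] (p ^ i))"
        using gc Z_carrier[OF g(2)] inv_equality by simp
      then have gp: "g [^] (p ^ (i + 1)) \<in> Z"
        using subgroup.m_inv_closed[OF subgroup_Z Z_pow[OF g(2)]] gc
        by (simp add: nat_pow_pow)
      \<comment> \<open>Since \<open>e\<close> is \<open>g [^] p\<close> up to a central factor, the
        one-sided bound with exponent 1 gives order dividing
        \<open>p ^ (i - 1) = p ^ m\<close>.\<close>
      have "comm e w \<in> \<Omega>" if w: "w \<in> H" "w [^] (p ^ i) \<in> Z" for w
      proof -
        have "comm e w = comm (g [^] p) w"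
          unfolding g(3)
          by (rule comm_mult_central(1)[OF _ Hc[OF w(1)] Z_carrier[OF g(2)] Z_central[OF g(2)]])
            (use gc in simp_all)
        moreover have "comm (g [^] p) w [^] (p ^ m) = \<one>"
          using comm_pow_left_bound[OF pe K g(1) w(1) gp w(2), of 1] Suc by simp
        ultimately show ?thesis using normal_in_comm[OF norA eA w(1)] by (simp add: \<Omega>_def)
      qed
      moreover have "e [^] p \<in> \<Omega>"
        using ep Suc ec subgroup_pow_closed[OF A eA] by (simp add: \<Omega>_def nat_pow_pow)
      ultimately obtain t where t: "t \<in> \<Omega>" "(x \<otimes> y) [^] p = x [^] p \<otimes> y [^] p \<otimes> t"
        using pow_mult_mod[OF norO prime odd xy] xy xp yp unfolding e_def by blast
      have tA: "t \<in> agemo H" "t [^] (p ^ m) = \<one>" using t(1) by (auto simp: \<Omega>_def)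
      have tc: "t \<in> carrier G" using subgroup.mem_carrier[OF A tA(1)] .
      have pm: "(w [^] p) [^] (p ^ m) = w [^] (p ^ i)" if "w \<in> carrier G" for w
        using that by (simp add: nat_pow_pow Suc)
      have xyA: "x [^] p \<in> agemo H" "y [^] p \<in> agemo H" using pow_in_agemo xy by auto
      have 1: "(x [^] p \<otimes> y [^] p) [^] (p ^ m) = x [^] (p ^ i) \<otimes> y [^] (p ^ i)"
        using agemo_add xyA xp yp pm car unfolding pow_additive_def by metis
      \<comment> \<open>Additivity in \<open>agemo H\<close> applies a second time because the
        \<open>p ^ m\<close>-th power of \<open>x [^] p \<otimes> y [^] p\<close> is a product of
        elements of \<open>Z\<close>; the error \<open>t\<close> then disappears.\<close>
      have "(x [^] p \<otimes> y [^] p \<otimes> t) [^] (p ^ m) = (x [^] p \<otimes> y [^] p) [^] (p ^ m) \<otimes> t [^] (p ^ m)"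
        using agemo_add subgroup.m_closed[OF A xyA] tA one_Z 1 subgroup.m_closed[OF subgroup_Z xp yp]
        unfolding pow_additive_def by metis
      then show ?thesis using pm[of "x \<otimes> y"] t(2) 1 tA(2) car by simp
    qed
    then show ?thesis unfolding pow_additive_def by blast
  qed
qed

end

section \<open>The centre and the passage back to quasi-powerful groups\<close>

context group
begin

lemma center_commutes: "z \<in> center G \<Longrightarrow> g \<in> carrier G \<Longrightarrow> z \<otimes> g = g \<otimes> z"
  unfolding center_def by blast

lemma center_carrier: "z \<in> center G \<Longrightarrow> z \<in> carrier G"
  unfolding center_def by blast

lemma subgroup_center: "subgroup (center G) G"
proof (rule subgroupI)
  show "center G \<subseteq> carrier G" using center_carrier by blast
  show "center G \<noteq> {}" using one_closed by (force simp: center_def)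
  show "inv a \<in> center G" if "a \<in> center G" for a
    using inv_commutes[OF center_carrier[OF that] _ center_commutes[OF that]] center_carrier[OF that]
    unfolding center_def by blast
  show "a \<otimes> b \<in> center G" if "a \<in> center G" "b \<in> center G" for a b
    using mult_commutes[OF center_carrier[OF that(1)] center_carrier[OF that(2)] _
        center_commutes[OF that(1)] center_commutes[OF that(2)]]
      center_carrier[OF that(1)] center_carrier[OF that(2)]
    unfolding center_def by blast
qed

lemma normal_center: "center G \<lhd> G"
proof -
  have "g \<otimes> z \<otimes> inv g = z" if "z \<in> center G" "g \<in> carrier G" for z g
    using center_carrier[OF that(1)] that(2)
    by (simp add: m_assoc flip: center_commutes[OF that])
  then show ?thesis using subgroup_center by (simp add: normal_inv_iff)
qed

lemma comm_eq_one_pow: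
  fixes s t :: nat
  assumes "a \<in> carrier G" "b \<in> carrier G" "comm a b = \<one>"
  shows "comm (a [^] s) (b [^] t) = \<one>"
proof -
  have "a \<otimes> b = b \<otimes> a" using assms comm_eq_one_iff by simp
  then have "a [^] s \<otimes> b = b \<otimes> a [^] s" using group_commutes_pow assms by simp
  then have "b [^] t \<otimes> a [^] s = a [^] s \<otimes> b [^] t"
    using group_commutes_pow[of b "a [^] s" t] assms by simp
  then show ?thesis using assms by (simp add: comm_eq_one_iff)
qed

end

context central_p_group
begin

text \<open>Subtraction of naturals truncates at 0, so the case of a negative exponent is stated
  separately as triviality.\<close>

lemma ord_comm_pow_le:
  assumes pe: "powerfully_embedded (carrier G) (carrier G)"
    and xy: "x \<in> carrier G" "y \<in> carrier G" and "ord x \<le> p ^ (i + 1)" "ord y \<le> p ^ i"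
  shows "if j + k \<le> i then ord (comm (x [^] (p ^ j)) (y [^] (p ^ k))) \<le> p ^ (i - j - k)
         else comm (x [^] (p ^ j)) (y [^] (p ^ k)) = \<one>"
proof -
  have K: "pow_additive (adjoin u (carrier G))" if "u \<in> carrier G" for u
    using pow_additive adjoin(2)[OF pe that] by blast
  \<comment> \<open>Orders are powers of \<open>p\<close>, so an inequality with
    \<open>p ^ r\<close> is a divisibility.\<close>
  have one: "g [^] (p ^ r) = \<one>" if "g \<in> carrier G" "ord g \<le> p ^ r" for g r
  proof -
    have "ord g dvd p ^ n" using ord_dvd_group_order[OF that(1)] order by simp
    then obtain s where s: "ord g = p ^ s" using divides_primepow_nat[OF prime] by blast
    then have "s \<le> r" using that(2) prime_gt_1_nat[OF prime] by (simp add: power_increasing_iff)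
    then show ?thesis using s that(1) by (simp add: pow_eq_id le_imp_power_dvd)
  qed
  have xp: "x [^] (p ^ (i + 1)) \<in> Z" and yp: "y [^] (p ^ i) \<in> Z"
    using one[OF xy(1) assms(4)] one[OF xy(2) assms(5)] one_Z by (simp_all only:)
  have bound: "comm (x [^] (p ^ j)) (y [^] (p ^ k)) [^] (p ^ (i - j - k)) = \<one>"
    if "j + k \<le> i" for j k
    by (rule comm_pow_bound[OF pe K xy xp yp that])
  show ?thesis
  proof (cases "j + k \<le> i")
    case True
    have "ord (comm (x [^] (p ^ j)) (y [^] (p ^ k))) dvd p ^ (i - j - k)"
      using bound[OF True] xy by (simp add: pow_eq_id)
    then show ?thesis
      using True prime_gt_0_nat[OF prime] by (simp add: dvd_imp_le)
  next
    case False
    \<comment> \<open>The exponents are reduced until their sum is exactly \<open>i\<close>, where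
      the bound says that the powers commute; higher powers of them then commute as well.\<close>
    define j' k' where "j' = min j i" and "k' = i - j'"
    have *: "j' \<le> j" "k' \<le> k" "j' + k' = i" using False by (auto simp: j'_def k'_def)
    have "comm (x [^] (p ^ j')) (y [^] (p ^ k')) = \<one>"
      using bound[of j' k'] * xy by auto
    then have "comm ((x [^] (p ^ j')) [^] (p ^ (j - j'))) ((y [^] (p ^ k')) [^] (p ^ (k - k'))) = \<one>"
      using comm_eq_one_pow xy by simp
    then show ?thesis using False * xy by (simp add: nat_pow_pow flip: power_add)
  qed
qed

end

text \<open>The \<open>p\<close>-th powers of the quotient are images of \<open>p\<close>-th powers
  of \<open>G\<close>, so a commutator agrees with a product of these or their inverses up to a
  central factor, and \<open>agemo\<close> contains the centre.\<close>

lemma quasi_powerful_powerfully_embedded: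
  fixes G (structure)
  assumes "central_p_group G p n (center G)" "quasi_powerful G p"
  shows "central_p_group.powerfully_embedded G p (center G) (carrier G) (carrier G)"
proof -
  interpret central_p_group G p n "center G" by (rule assms(1))
  interpret nZ: normal "center G" G by (rule normal_center)
  define Q where "Q = G Mod center G"
  define \<pi> where "\<pi> = (\<lambda>a. center G #>\<^bsub>G\<^esub> a)"
  have "\<pi> \<in> hom G Q" unfolding \<pi>_def Q_def by (rule nZ.r_coset_hom_Mod)
  then have "group_hom G Q \<pi>"
    unfolding group_hom_def group_hom_axioms_def Q_def
    using nZ.factorgroup_is_group group_axioms by blast
  then interpret h: group_hom G Q \<pi> .
  have surj: "carrier Q = \<pi> ` carrier G" by (auto simp: Q_def \<pi>_def FactGroup_def RCOSETS_def)
  have "comm x y \<in> agemo (carrier G)" if xy: "x \<in> carrier G" "y \<in> carrier G" for x y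
  proof -
    \<comment> \<open>The library builds \<open>derived\<close> from commutators with the inverses
      on the right; inserting the inverses of both images matches the convention used here.\<close>
    have "\<pi> (comm x y) = (inv\<^bsub>Q\<^esub> \<pi> x) \<otimes>\<^bsub>Q\<^esub> (inv\<^bsub>Q\<^esub> \<pi> y) \<otimes>\<^bsub>Q\<^esub> inv\<^bsub>Q\<^esub> (inv\<^bsub>Q\<^esub> \<pi> x) \<otimes>\<^bsub>Q\<^esub> inv\<^bsub>Q\<^esub> (inv\<^bsub>Q\<^esub> \<pi> y)"
      using xy by (simp add: commutator_def)
    also have "\<dots> \<in> derived Q (carrier Q)"
      unfolding derived_def using xy
      by (intro generate.incl UN_I[of "inv\<^bsub>Q\<^esub> \<pi> x" "carrier Q"] UN_I[of "inv\<^bsub>Q\<^esub> \<pi> y" "carrier Q"])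
        simp_all
    also have "\<dots> \<subseteq> power_subgroup Q p"
      using assms(2) by (simp add: quasi_powerful_def powerful_def Q_def)
    also have "power_subgroup Q p = generate Q (\<pi> ` {g [^] p | g. g \<in> carrier G})"
    proof -
      have "{y [^]\<^bsub>Q\<^esub> p | y. y \<in> carrier Q} = \<pi> ` {g [^] p | g. g \<in> carrier G}"
        unfolding surj using h.hom_nat_pow by force
      then show ?thesis by (simp add: power_subgroup_def)
    qed
    also have "\<dots> = \<pi> ` generate G {g [^] p | g. g \<in> carrier G}"
      by (rule h.generate_img) blast
    finally obtain w where w: "w \<in> generate G {g [^] p | g. g \<in> carrier G}" "\<pi> (comm x y) = \<pi> w"
      by blast
    have wc: "w \<in> carrier G" using w(1) by (rule generate_in_carrier[rotated]) blast
    have "comm x y \<in> center G #>\<^bsub>G\<^esub> w"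
      using w(2) rcos_self[OF _ subgroup_center, of "comm x y"] xy by (simp add: \<pi>_def)
    then obtain z where z: "z \<in> center G" "comm x y = z \<otimes> w" by (auto simp: r_coset_def)
    have "w \<in> agemo (carrier G)"
      using w(1) mono_generate[of "{g [^] p | g. g \<in> carrier G}"] by (auto simp: agemo_def)
    then show ?thesis
      using z Z_subset_agemo unfolding agemo_def by (auto intro: generate.eng)
  qed
  moreover have "normal_in (carrier G) (carrier G)"
    by (rule normal_inI) (auto intro: subgroup_self)
  ultimately show ?thesis
    unfolding powerfully_embedded_def using center_carrier by blast
qed

theorem theorem4:
  fixes G :: "('a, 'b) monoid_scheme" and p i j k :: nat and x y :: 'a
  assumes "Factorial_Ring.prime p" and "odd p"
    and "quasi_powerful G p"
    and "x \<in> carrier G" and "y \<in> carrier G"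
    and "group.ord G x \<le> p ^ (i + 1)"
    and "group.ord G y \<le> p ^ i"
  shows "if j + k \<le> i
         then group.ord G (commutator G (x [^]\<^bsub>G\<^esub> (p ^ j)) (y [^]\<^bsub>G\<^esub> (p ^ k))) \<le> p ^ (i - j - k)
         else commutator G (x [^]\<^bsub>G\<^esub> (p ^ j)) (y [^]\<^bsub>G\<^esub> (p ^ k)) = \<one>\<^bsub>G\<^esub>"
proof -
  obtain n where n: "group G" "order G = p ^ n"
    using assms(3) by (auto simp: quasi_powerful_def p_group_def)
  interpret group G by (rule n(1))
  have cpg: "central_p_group G p n (center G)"
    by (intro central_p_group.intro finite_p_group.intro finite_p_group_axioms.intro
        central_p_group_axioms.intro group_axioms assms(1,2) n(2) subgroup_center)
      (erule center_commutes, assumption)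
  interpret central_p_group G p n "center G" by (rule cpg)
  show ?thesis
    using ord_comm_pow_le[OF quasi_powerful_powerfully_embedded[OF cpg assms(3)] assms(4-7)] .
qed

end
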